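(* (a) $\lim_{n\to\infty}\frac1n\sum_{k=1}^n\mathsf a'_k=\infty$ Lebesgue-almost everywhere. (b) (Trimmed strong law) Lebesgue-almost everywhere, \[ \lim_{n\to\infty}\frac{\log 2}{n\log\log n}\Big(\sum_{k=1}^n\mathsf a'_k-\mathsf M'_n\Big)=1 . \]
   Context: $I=(0,1]$, $\lambda$ is Lebesgue measure on $I$, and $\mathsf a_n(x)$ denotes the $n$-th continued fraction digit of $x\in I$. $\mathbb P$ is the set of primes. The prime digits are $\mathsf a'_n(x):=\mathsf a_n(x)$ if $\mathsf a_n(x)\in\mathbb P$ and $\mathsf a'_n(x):=0$ otherwise; $\mathsf M'_n:=\max_{1\le k\le n}\mathsf a'_k$. *)

theory Defs
  imports "HOL-Analysis.Analysis" "HOL-Computational_Algebra.Primes"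
begin

definition gauss_map :: "real \<Rightarrow> real" where
  "gauss_map x = (if x = 0 then 0 else frac (1 / x))"

text \<open>n-th continued fraction digit (n \<ge> 1) of x in (0,1]:
  a_n x = floor (1 / T^(n-1) x); by convention 0 once the expansion has terminated
  (only relevant for rational x, a Lebesgue null set).\<close>
definition cf_digit :: "nat \<Rightarrow> real \<Rightarrow> nat" where
  "cf_digit n x = (let y = (gauss_map ^^ (n - 1)) x in
                     if y = 0 then 0 else nat \<lfloor>1 / y\<rfloor>)"

definition prime_digit :: "nat \<Rightarrow> real \<Rightarrow> nat" where
  "prime_digit n x = (if prime (cf_digit n x) then cf_digit n x else 0)"

definition max_prime_digit :: "nat \<Rightarrow> real \<Rightarrow> nat" where
  "max_prime_digit n x = Max ((\<lambda>k. prime_digit k x) ` {1..n})"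

end

theory Submission
  imports Defs "HOL-Number_Theory.Prime_Powers" "HOL-Probability.Probability" "HOL-Real_Asymp.Real_Asymp"
begin

text \<open>
  Under the Gauss measure the prime digit equals \<open>p\<close> with probability about \<open>1 / (p^2 ln 2)\<close>, so by
  Mertens' second theorem its mean truncated at \<open>f\<close> is \<open>ln (ln f) / ln 2 + O(1)\<close>, and by Chebyshev's
  bound its truncated second moment is \<open>O(f / ln f)\<close>. The transfer operator of the Gauss map sends
  monotone functions to monotone functions and halves their oscillation, which makes correlations of
  digits decay geometrically; so a truncated sum of \<open>n\<close> digits has variance \<open>O(n f / ln f)\<close>.
  Along the times \<open>exp (j powr (9/10))\<close>, with truncation slightly below them, these variances are
  summable after normalisation, and so are the probabilities that two digits of one
  initial segment exceed the truncation level. Hence almost surely the sum without its maximum differs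
  from the truncated sum by at most the truncation level. Part (a) is immediate from part (b), since the
  maximum is nonnegative and \<open>ln (ln n)\<close> is unbounded.
\<close>

section \<open>Mertens' theorems\<close>

text \<open>The restriction to primes gains a logarithm twice: the truncated second moment is O(f /
  ln f), and a prime digit above f has probability O(1 / (f ln f)). For n digits this gives the mean
  a variance of order f / (n ln f), and two exceedances a probability of order (n / (f ln f))^2.
  Without the logarithms the orders would be f / n and (n / f)^2, which cannot both be small. For
  times exp (j powr a) and a level smaller by the factor j powr b, summability asks for a + b > 1
  and a - b > 1/2, while the ratio of consecutive times tends to 1 only for a < 1. So a lies
  strictly between 3/4 and 1, and b = a / 3 gives both series the same exponent. The contraction
  argument handles monotone functions only, and the indicator of a digit is not monotone. One
  application of the transfer operator turns it into the explicit function \<open>cf_prob m\<close>,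
  a difference of two monotone functions; the remaining iterates contract. Double exceedances use no
  decay of correlations: a pointwise bound on the transferred indicator already makes the
  probability of a pair at most a product.\<close>

lemma ln_fact_eq_sum_mangoldt:
  assumes "n \<le> N"
  shows "ln (fact n :: real) = (\<Sum>d=1..N. mangoldt d * real (n div d))"
  using assms
proof (induction n)
  case (Suc n)
  have "ln (fact (Suc n) :: real) = ln (real (Suc n)) + ln (fact n)"
    by (simp add: ln_mult)
  also have "ln (real (Suc n)) = (\<Sum>d | d dvd Suc n. mangoldt d)"
    using mangoldt_sum[of "Suc n", where ?'a = real] by simp
  also have "\<dots> = (\<Sum>d=1..N. if d dvd Suc n then mangoldt d else 0)"
    unfolding sum.inter_filter[symmetric, OF finite_atLeastAtMost]
    using Suc.prems by (intro sum.cong) (auto dest: dvd_imp_le intro!: Suc_leI dvd_pos_nat[of "Suc n"])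
  also have "\<dots> + ln (fact n) = (\<Sum>d=1..N. (if d dvd Suc n then mangoldt d else 0) + mangoldt d * real (n div d))"
    using Suc by (simp add: sum.distrib)
  also have "\<dots> = (\<Sum>d=1..N. mangoldt d * real (Suc n div d))"
    by (intro sum.cong) (auto simp: div_Suc algebra_simps dvd_eq_mod_eq_0)
  finally show ?case .
qed simp

definition psi :: "nat \<Rightarrow> real" where
  "psi n = (\<Sum>d=1..n. mangoldt d)"

lemma psi_mono: "m \<le> n \<Longrightarrow> psi m \<le> psi n"
  unfolding psi_def by (intro sum_mono2) (auto simp: mangoldt_nonneg)

text \<open>Chebyshev's argument with the central binomial coefficient. Its logarithm is a
  \<open>mangoldt\<close> sum whose coefficients, floor (2n/d) - 2 floor (n/d), are nonnegative and
  equal 1 for n < d <= 2n, and the binomial coefficient is at most 4^n.\<close>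

lemma psi_double_le: "psi (2 * n) \<le> psi n + 2 * real n * ln 2"
proof -
  have "psi (2*n) - psi n = (\<Sum>d\<in>{1..2*n} - {1..n}. mangoldt d)"
    unfolding psi_def by (subst sum_diff) auto
  also have "\<dots> \<le> (\<Sum>d\<in>{1..2*n} - {1..n}. mangoldt d * (real (2 * n div d) - 2 * real (n div d)))"
  proof (intro sum_mono)
    fix d assume d: "d \<in> {1..2*n} - {1..n}"
    then have "2 * n div d = 1" "n div d = 0" by (auto intro!: div_nat_eqI)
    then show "mangoldt d \<le> mangoldt d * (real (2 * n div d) - 2 * real (n div d))"
      by simp
  qed
  also have "\<dots> \<le> (\<Sum>d\<in>{1..2*n}. mangoldt d * (real (2 * n div d) - 2 * real (n div d)))"
  proof (intro sum_mono2)
    fix d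
    have "2 * (n div d) \<le> 2 * n div d"
    proof (cases "d = 0")
      case False
      then show ?thesis by (simp add: less_eq_div_iff_mult_less_eq)
    qed simp
    then have "2 * real (n div d) \<le> real (2 * n div d)"
      by linarith
    then show "0 \<le> mangoldt d * (real (2 * n div d) - 2 * real (n div d))"
      by (simp add: mangoldt_nonneg)
  qed auto
  \<comment> \<open>The free upper limit in \<open>ln_fact_eq_sum_mangoldt\<close> serves this step:
    both factorials become sums over the same range.\<close>
  also have "\<dots> = ln (fact (2*n)) - 2 * ln (fact n)"
    unfolding ln_fact_eq_sum_mangoldt[OF order_refl, of "2*n"] ln_fact_eq_sum_mangoldt[of n "2*n", OF le_add1[of n n, folded mult_2]]
    by (simp only: sum_subtractf sum_distrib_left right_diff_distrib mult.left_commute)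
  also have "\<dots> = ln (real (2*n choose n))"
    by (simp add: binomial_fact ln_div ln_mult)
  also have "\<dots> \<le> ln (2 ^ (2*n))"
  proof -
    have "0 < (2*n choose n)" by simp
    moreover have "real (2*n choose n) \<le> 2 ^ (2*n)"
      using binomial_le_pow2[of "2*n" n] by (metis of_nat_le_iff of_nat_numeral of_nat_power)
    ultimately show ?thesis by (subst ln_le_cancel_iff) auto
  qed
  also have "\<dots> = 2 * real n * ln 2"
    by (simp add: ln_realpow)
  finally show ?thesis by simp
qed

lemma ln2_le_1: "ln (2::real) \<le> 1"
  using ln_le_minus_one[of 2] by simp

text \<open>Induction by halving. With m the upper half of n, the bound 4m + 2m = 6m is at most 3(n
  + 1), and this is at most 4n exactly when n >= 3; smaller n are computed.\<close>

lemma psi_le: "psi n \<le> 4 * real n"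
proof (induction n rule: less_induct)
  case (less n)
  have mangoldt_2: "mangoldt (Suc (Suc 0)) = ln (2::real)"
    using mangoldt_prime[OF two_is_prime_nat, where ?'a = real] by (simp add: numeral_2_eq_2 del: mangoldt_prime)
  consider "n = 0" | "n = 1" | "n = 2" | "n \<ge> 3" by linarith
  then show ?case
  proof cases
    assume n: "n \<ge> 3"
    define m where "m = (n + 1) div 2"
    have m: "m < n" "n \<le> 2 * m" "2 * m \<le> n + 1" using n by (auto simp: m_def)
    have "psi n \<le> psi m + 2 * real m * ln 2"
      using psi_mono[OF m(2)] psi_double_le[of m] by linarith
    also have "\<dots> \<le> 4 * real m + 2 * real m * 1"
      using less.IH[OF m(1)] ln2_le_1 by (intro add_mono mult_left_mono) auto
    also have "\<dots> \<le> 4 * real n" using m n by linarith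
    finally show ?thesis .
  qed (use ln2_le_1 in \<open>auto simp: mangoldt_2 psi_def numeral_2_eq_2\<close>)
qed

lemma ln_fact_le: "ln (fact n :: real) \<le> real n * ln (real n)"
proof (cases "n = 0")
  case False
  have "ln (fact n :: real) \<le> ln (real (n ^ n))"
    using False by (subst ln_le_cancel_iff) (auto simp: fact_le_power simp flip: of_nat_power)
  then show ?thesis using False by (simp add: ln_realpow)
qed simp

lemma ln_fact_ge: "real n * ln (real n) - real n \<le> ln (fact n :: real)"
proof (induction n)
  case (Suc n)
  have "real n * (ln (real (Suc n)) - ln (real n)) \<le> 1"
  proof (cases "n = 0")
    case False
    have "ln (real (Suc n)) - ln (real n) = ln (1 + 1 / real n)"
      using False ln_div[of "real (Suc n)" "real n"] by (simp add: add_divide_distrib add.commute)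
    also have "\<dots> \<le> 1 / real n" by (rule ln_add_one_self_le_self) simp
    finally show ?thesis using False by (simp add: field_simps)
  qed simp
  moreover have "ln (fact (Suc n) :: real) = ln (real (Suc n)) + ln (fact n)"
    by (simp add: ln_mult)
  ultimately show ?case using Suc by (simp add: algebra_simps)
qed simp

text \<open>Replacing floor (n/d) by n/d in the formula for ln n! costs at most
  \<open>psi n\<close>, hence at most 4n; division by n leaves a constant.\<close>

lemma sum_mangoldt_over_bounds:
  assumes "n > 0"
  shows "\<bar>(\<Sum>d=1..n. mangoldt d / real d) - ln (real n)\<bar> \<le> 4"
proof -
  have "real n * (\<Sum>d=1..n. mangoldt d / real d) \<ge> ln (fact n)"
    unfolding ln_fact_eq_sum_mangoldt[OF order_refl] sum_distrib_left
  proof (intro sum_mono)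
    fix d assume "d \<in> {1..n}"
    have "mangoldt d * real (n div d) \<le> mangoldt d * (real n / real d)"
      by (intro mult_left_mono mangoldt_nonneg) (simp add: of_nat_div_le_of_nat)
    then show "mangoldt d * real (n div d) \<le> real n * (mangoldt d / real d)"
      by (simp add: mult_ac)
  qed
  moreover have "real n * (\<Sum>d=1..n. mangoldt d / real d) \<le> ln (fact n) + psi n"
    unfolding ln_fact_eq_sum_mangoldt[OF order_refl] sum_distrib_left psi_def sum.distrib[symmetric]
  proof (intro sum_mono)
    fix d assume "d \<in> {1..n}"
    have "real n / real d \<le> real (n div d) + 1"
      using real_of_int_div3[of "int n" "int d"] by (simp flip: of_nat_div)
    then have "mangoldt d * (real n / real d) \<le> mangoldt d * (real (n div d) + 1)"
      by (intro mult_left_mono mangoldt_nonneg)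
    then show "real n * (mangoldt d / real d) \<le> mangoldt d * real (n div d) + mangoldt d"
      by (simp add: algebra_simps)
  qed
  ultimately have "real n * (ln (real n) - 1) \<le> real n * (\<Sum>d=1..n. mangoldt d / real d)"
     "real n * (\<Sum>d=1..n. mangoldt d / real d) \<le> real n * (ln (real n) + 4)"
    using ln_fact_le[of n] ln_fact_ge[of n] psi_le[of n] by (auto simp: algebra_simps)
  then have "ln (real n) - 1 \<le> (\<Sum>d=1..n. mangoldt d / real d)"
     "(\<Sum>d=1..n. mangoldt d / real d) \<le> ln (real n) + 4"
    using assms by (auto simp: mult_le_cancel_left_pos)
  then show ?thesis by linarith
qed

lemma sum_powers_le:
  assumes "p > (1::nat)"
  shows "(\<Sum>i=2..n. 1 / real p ^ i) \<le> 1 / (real p * (real p - 1))"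
proof -
  \<comment> \<open>The subtracted term is the tail of the geometric series beyond n, kept so that
    the induction closes. For n = 0 it would exceed the whole series from exponent 2 on, hence the
    case distinction.\<close>
  have "(\<Sum>i=2..n. 1 / real p ^ i) \<le> 1 / (real p * (real p - 1)) - (if n \<ge> 1 then 1 / (real p ^ n * (real p - 1)) else 0)"
  proof (induction n)
    case (Suc n)
    show ?case
    proof (cases "n \<ge> 1")
      case True
      then have "(\<Sum>i=2..Suc n. 1 / real p ^ i) = (\<Sum>i=2..n. 1 / real p ^ i) + 1 / real p ^ Suc n"
        by simp
      moreover have "1 / (real p ^ n * (real p - 1)) = 1 / real p ^ Suc n + 1 / (real p ^ Suc n * (real p - 1))"
        using assms by (simp add: divide_simps)
      ultimately show ?thesis using Suc True by simp
    next
      case False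
      then have "n = 0" by simp
      then show ?thesis using assms by simp
    qed
  qed (use assms in simp)
  also have "\<dots> \<le> 1 / (real p * (real p - 1))"
    using assms by auto
  finally show ?thesis .
qed

text \<open>The powers of p with exponent at least 2 contribute at most ln p / (p (p - 1)) together,
  and this series converges even over all integers p.\<close>

lemma sum_nonprime_mangoldt_bounded:
  "\<exists>C. \<forall>n. (\<Sum>d=1..n. if prime d then 0 else mangoldt d / real d) \<le> C"
proof -
  let ?g = "\<lambda>p::nat. ln (real p) / (real p * (real p - 1))"
  have "summable ?g"
  proof (rule summable_comparison_test_bigo)
    show "summable (\<lambda>n. norm (real n powr -1.5))"
      by (simp add: summable_real_powr_iff)
    show "?g \<in> O(\<lambda>n. real n powr -1.5)" by real_asymp
  qed
  have g_nonneg: "?g p \<ge> 0" for p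
    by (cases p) auto
  have "(\<Sum>d=1..n. if prime d then 0 else mangoldt d / real d) \<le> suminf ?g" for n
  proof -
    let ?D = "{d\<in>{1..n}. primepow d \<and> \<not> prime d}"
    let ?F = "\<lambda>(p, i). p ^ i"
    have sub: "?D \<subseteq> ?F ` ({p\<in>{2..n}. prime p} \<times> {2..n})"
    proof
      fix d assume "d \<in> ?D"
      then have d: "primepow d" "\<not> prime d" "d \<le> n" by auto
      from d(1) obtain p k where pk: "prime p" "k > 0" "d = p ^ k"
        by (auto simp: primepow_def)
      have "k \<noteq> 1" using pk d by auto
      with pk have k: "k \<ge> 2" by linarith
      have p: "p \<ge> 2" using pk prime_ge_2_nat by auto
      have "k < p ^ k" using p by (intro power_gt_expt) auto
      moreover have "p \<le> p ^ k" using p k by (intro self_le_power) auto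
      ultimately show "d \<in> ?F ` ({p\<in>{2..n}. prime p} \<times> {2..n})"
        using pk d k p by (intro image_eqI[of _ _ "(p, k)"]) auto
    qed
    have "(\<Sum>d=1..n. if prime d then 0 else mangoldt d / real d) = (\<Sum>d\<in>?D. mangoldt d / real d)"
      by (intro sum.mono_neutral_cong_right) (auto simp: mangoldt_def)
    also have "\<dots> \<le> (\<Sum>d\<in>?F ` ({p\<in>{2..n}. prime p} \<times> {2..n}). mangoldt d / real d)"
      using sub by (intro sum_mono2) (auto simp: mangoldt_nonneg)
    also have "\<dots> \<le> (\<Sum>x\<in>({p\<in>{2..n}. prime p} \<times> {2..n}). mangoldt (?F x) / real (?F x))"
      by (rule order_trans[OF sum_image_le]) (auto simp: mangoldt_nonneg)
    also have "\<dots> = (\<Sum>p\<in>{p\<in>{2..n}. prime p}. \<Sum>i\<in>{2..n}. ln (real p) * (1 / real p ^ i))"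
      unfolding sum.cartesian_product by (intro sum.cong) auto
    also have "\<dots> = (\<Sum>p\<in>{p\<in>{2..n}. prime p}. ln (real p) * (\<Sum>i\<in>{2..n}. 1 / real p ^ i))"
      by (simp only: sum_distrib_left)
    also have "\<dots> \<le> (\<Sum>p\<in>{p\<in>{2..n}. prime p}. ?g p)"
    proof (intro sum_mono)
      fix p assume "p \<in> {p\<in>{2..n}. prime p}"
      then have "p > 1" by auto
      then have "ln (real p) * (\<Sum>i\<in>{2..n}. 1 / real p ^ i) \<le> ln (real p) * (1 / (real p * (real p - 1)))"
        by (intro mult_left_mono sum_powers_le) auto
      then show "ln (real p) * (\<Sum>i\<in>{2..n}. 1 / real p ^ i) \<le> ?g p" by simp
    qed
    also have "\<dots> \<le> suminf ?g"
      using g_nonneg \<open>summable ?g\<close> by (intro sum_le_suminf) auto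
    finally show ?thesis .
  qed
  then show ?thesis by blast
qed

lemma mertens_first:
  "\<exists>C. \<forall>n>0. \<bar>(\<Sum>p\<in>{p\<in>{1..n}. prime p}. ln (real p) / real p) - ln (real n)\<bar> \<le> C"
proof -
  obtain C where C: "\<And>n. (\<Sum>d=1..n. if prime d then 0 else mangoldt d / real d) \<le> C"
    using sum_nonprime_mangoldt_bounded by blast
  have "\<bar>(\<Sum>p\<in>{p\<in>{1..n}. prime p}. ln (real p) / real p) - ln (real n)\<bar> \<le> 4 + C" if "n > 0" for n
  proof -
    have "(\<Sum>d=1..n. mangoldt d / real d) =
        (\<Sum>d=1..n. if prime d then mangoldt d / real d else 0) + (\<Sum>d=1..n. if prime d then 0 else mangoldt d / real d)"
      unfolding sum.distrib[symmetric] by (intro sum.cong) auto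
    also have "(\<Sum>d=1..n. if prime d then mangoldt d / real d else 0) = (\<Sum>p\<in>{p\<in>{1..n}. prime p}. ln (real p) / real p)"
      unfolding sum.inter_filter[symmetric, OF finite_atLeastAtMost] by (intro sum.cong) auto
    finally have "(\<Sum>p\<in>{p\<in>{1..n}. prime p}. ln (real p) / real p) = 
       (\<Sum>d=1..n. mangoldt d / real d) - (\<Sum>d=1..n. if prime d then 0 else mangoldt d / real d)"
      by simp
    moreover have "(\<Sum>d=1..n. if prime d then 0 else mangoldt d / real d) \<ge> (0::real)"
      by (intro sum_nonneg) (auto simp: mangoldt_nonneg)
    ultimately show ?thesis using C[of n] sum_mangoldt_over_bounds[OF that] by linarith
  qed
  then show ?thesis by blast
qed

text \<open>Summation by parts, used with the weights 1 / ln m to pass from the terms ln p / p to 1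
  / p.\<close>

lemma abel_sum_bounded:
  fixes a c :: "nat \<Rightarrow> real"
  assumes A: "\<And>n. \<bar>\<Sum>m=k..n. a m\<bar> \<le> C"
    and c: "\<And>m. m \<ge> k \<Longrightarrow> c (Suc m) \<le> c m" "\<And>m. m \<ge> k \<Longrightarrow> c m \<ge> 0"
    and "n \<ge> k"
  shows "\<bar>\<Sum>m=k..n. a m * c m\<bar> \<le> C * c k"
proof -
  \<comment> \<open>The boundary term is split off: what remains changes at each step by a partial
    sum of \<open>a\<close> times a decrement of \<open>c\<close>, and the decrements
    telescope.\<close>
  have "\<bar>(\<Sum>m=k..n. a m * c m) - (\<Sum>m=k..n. a m) * c n\<bar> \<le> C * (c k - c n)"
    using \<open>n \<ge> k\<close>
  proof (induction n rule: dec_induct)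
    case (step n)
    have "(\<Sum>m=k..Suc n. a m * c m) - (\<Sum>m=k..Suc n. a m) * c (Suc n) =
       ((\<Sum>m=k..n. a m * c m) - (\<Sum>m=k..n. a m) * c n) + (\<Sum>m=k..n. a m) * (c n - c (Suc n))"
      using step by (simp add: algebra_simps)
    moreover have "\<bar>(\<Sum>m=k..n. a m) * (c n - c (Suc n))\<bar> \<le> C * (c n - c (Suc n))"
      using A[of n] c(1)[of n] step by (auto simp: abs_mult intro!: mult_mono)
    ultimately show ?case using step.IH by (simp add: algebra_simps)
  qed simp
  moreover have "\<bar>(\<Sum>m=k..n. a m) * c n\<bar> \<le> C * c n"
    using A[of n] c(2)[OF \<open>n \<ge> k\<close>] by (auto simp: abs_mult intro!: mult_right_mono)
  ultimately show ?thesis by (simp add: algebra_simps)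
qed

lemma ln_step_bounds:
  assumes "m \<ge> 2"
  shows "ln (real (Suc m)) - ln (real m) \<ge> 0" "ln (real (Suc m)) - ln (real m) \<le> ln 2"
proof -
  have "real (Suc m) \<le> 2 * real m" using assms by simp
  then have "ln (real (Suc m)) \<le> ln (2 * real m)" using assms by (subst ln_le_cancel_iff) auto
  then show "ln (real (Suc m)) - ln (real m) \<le> ln 2" using assms by (simp add: ln_mult)
qed (use assms in auto)

text \<open>In the variable t = ln m this is a right-endpoint Riemann sum for the integral of 1/t,
  whose value is ln (ln n) up to a constant. A step from u to v has error at most ln 2 (1/u - 1/v);
  these errors telescope, and the term \<open>ln 2 / ln (real n)\<close> records what is left of
  them.\<close>

lemma sum_ln_diff_over_ln:
  assumes "n \<ge> 2"
  shows "(\<Sum>m=2..n. (ln (real m) - ln (real (m - 1))) / ln (real m)) - ln (ln (real n)) \<le> 1 - ln (ln 2)"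
    and "(\<Sum>m=2..n. (ln (real m) - ln (real (m - 1))) / ln (real m)) - ln (ln (real n)) \<ge> ln 2 / ln (real n) - ln (ln 2)"
  using assms
proof (induction n rule: dec_induct)
  case base
  {
    case 1 show ?case by simp
  next
    case 2 show ?case by simp
  }
next
  case (step n)
  define u v where "u = ln (real n)" and "v = ln (real (Suc n))"
  have uv: "0 < u" "u \<le> v" "v - u \<le> ln 2"
    using step ln_step_bounds[of n] by (auto simp: u_def v_def)
  have S: "(\<Sum>m=2..Suc n. (ln (real m) - ln (real (m - 1))) / ln (real m)) =
     (\<Sum>m=2..n. (ln (real m) - ln (real (m - 1))) / ln (real m)) + (v - u) / v"
    using step by (simp add: u_def v_def)
  have "ln (u / v) \<le> u / v - 1" using uv by (intro ln_le_minus_one) auto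
  then have 1: "(v - u) / v \<le> ln v - ln u" using uv by (simp add: ln_div diff_divide_distrib)
  have "ln (v / u) \<le> v / u - 1" using uv by (intro ln_le_minus_one) auto
  then have "ln v - ln u \<le> (v - u) / u" using uv by (simp add: ln_div diff_divide_distrib)
  also have "(v - u) / u = (v - u) / v + (v - u) * (1 / u - 1 / v)"
    using uv by (simp add: field_simps)
  also have "\<dots> \<le> (v - u) / v + ln 2 * (1 / u - 1 / v)"
    using uv by (intro add_left_mono mult_right_mono) (auto simp: frac_le)
  finally have 2: "ln v - ln u \<le> (v - u) / v + ln 2 / u - ln 2 / v"
    by (simp add: algebra_simps)
  {
    case 1
    show ?case using step.IH(1) \<open>(v - u) / v \<le> ln v - ln u\<close> step S
      by (simp add: u_def v_def)
  next
    case 2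
    show ?case using step.IH(2) \<open>ln v - ln u \<le> (v - u) / v + ln 2 / u - ln 2 / v\<close> step S
      by (simp add: u_def v_def)
  }
qed

lemma mertens_second:
  "\<exists>C. \<forall>n\<ge>2. \<bar>(\<Sum>p\<in>{p\<in>{1..n}. prime p}. 1 / real p) - ln (ln (real n))\<bar> \<le> C"
proof -
  obtain C where C: "\<And>n. n > 0 \<Longrightarrow> \<bar>(\<Sum>p\<in>{p\<in>{1..n}. prime p}. ln (real p) / real p) - ln (real n)\<bar> \<le> C"
    using mertens_first by blast
  define b where "b = (\<lambda>m. ln (real m) - ln (real (m - 1)))"
  \<comment> \<open>The weight of m as a prime, minus the increment of the logarithm. The increments
    telescope to ln n, so Mertens' first theorem says that the partial sums of \<open>a\<close> are
    bounded.\<close>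
  define a where "a = (\<lambda>m. (if prime m then ln (real m) / real m else 0) - b m)"
  have tele: "(\<Sum>m=2..n. b m) = ln (real n)" if "n \<ge> 1" for n
    using that by (induction n rule: dec_induct) (auto simp: b_def)
  have primes: "(\<Sum>p\<in>{p\<in>{1..n}. prime p}. g p) = (\<Sum>m=2..n. if prime m then g m else 0)" for g :: "nat \<Rightarrow> real" and n
    by (intro sum.mono_neutral_cong_left) (auto dest: prime_ge_2_nat)
  have C0: "0 \<le> C" using C[of 1] by auto
  have Ab: "\<bar>\<Sum>m=2..n. a m\<bar> \<le> C" for n
  proof (cases "n \<ge> 1")
    case True
    then show ?thesis using C[of n] tele[of n] unfolding a_def sum_subtractf primes by simp
  qed (use C0 in \<open>auto simp: not_le\<close>)
  have "\<bar>(\<Sum>p\<in>{p\<in>{1..n}. prime p}. 1 / real p) - ln (ln (real n))\<bar> \<le> C * (1 / ln 2) + 1 + \<bar>ln (ln 2)\<bar>"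
    if n: "n \<ge> 2" for n
  proof -
    have "\<bar>\<Sum>m=2..n. a m * (1 / ln (real m))\<bar> \<le> C * (1 / ln (real 2))"
      using Ab n by (intro abel_sum_bounded) (auto intro!: frac_le)
    also have "(\<Sum>m=2..n. a m * (1 / ln (real m))) =
       (\<Sum>m=2..n. (if prime m then 1 / real m else 0) - b m / ln (real m))"
      by (intro sum.cong) (auto simp: a_def field_simps)
    also have "\<dots> = (\<Sum>p\<in>{p\<in>{1..n}. prime p}. 1 / real p) - (\<Sum>m=2..n. b m / ln (real m))"
      unfolding sum_subtractf primes by simp
    finally have "\<bar>(\<Sum>p\<in>{p\<in>{1..n}. prime p}. 1 / real p) - (\<Sum>m=2..n. b m / ln (real m))\<bar> \<le> C * (1 / ln 2)"
      by simp
    moreover have "ln 2 / ln (real n) \<ge> 0" using n by simp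
    ultimately show ?thesis using sum_ln_diff_over_ln[OF n] unfolding b_def by linarith
  qed
  then show ?thesis by blast
qed

section \<open>Chebyshev-type bounds: counting primes and tails of the sum of 1/p^2\<close>

lemma prime_mangoldt_sum_le:
  assumes "finite A" "\<And>m. m \<in> A \<Longrightarrow> c m \<ge> 0"
  shows "(\<Sum>p\<in>{p\<in>A. prime p}. ln (real p) * c p) \<le> (\<Sum>m\<in>A. mangoldt m * c m :: real)"
proof -
  have "(\<Sum>p\<in>{p\<in>A. prime p}. ln (real p) * c p) = (\<Sum>p\<in>{p\<in>A. prime p}. mangoldt p * c p)"
    by (intro sum.cong) auto
  also have "\<dots> \<le> (\<Sum>m\<in>A. mangoldt m * c m :: real)"
    using assms by (intro sum_mono2) (auto simp: mangoldt_nonneg)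
  finally show ?thesis .
qed

text \<open>Each prime above sqrt n has weight at least (ln n) / 2 in \<open>psi n\<close>, so
  \<open>psi_le\<close> leaves room for at most 8n / ln n of them. The others number at most sqrt n,
  which is at most 2n / ln n.\<close>

lemma card_primes_le:
  assumes "n \<ge> 2"
  shows "real (card {p\<in>{1..n}. prime p}) \<le> 10 * real n / ln (real n)"
proof -
  let ?s = "sqrt (real n)"
  let ?L = "{p\<in>{1..n}. prime p \<and> real p > ?s}"
  have ln_pos: "ln (real n) > 0" using assms by simp
  have "{p\<in>{1..n}. prime p} \<subseteq> {1..nat \<lfloor>?s\<rfloor>} \<union> ?L"
    using le_nat_floor by (auto intro!: Suc_leI prime_gt_0_nat leI simp: linorder_not_le) (meson linorder_not_le le_nat_floor)
  then have "card {p\<in>{1..n}. prime p} \<le> card ({1..nat \<lfloor>?s\<rfloor>} \<union> ?L)"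
    by (intro card_mono) auto
  also have "\<dots> \<le> card {1..nat \<lfloor>?s\<rfloor>} + card ?L"
    by (rule card_Un_le)
  finally have "card {p\<in>{1..n}. prime p} \<le> nat \<lfloor>?s\<rfloor> + card ?L" by simp
  then have "real (card {p\<in>{1..n}. prime p}) \<le> real (nat \<lfloor>?s\<rfloor> + card ?L)"
    by (simp only: of_nat_le_iff)
  then have "real (card {p\<in>{1..n}. prime p}) \<le> real (nat \<lfloor>?s\<rfloor>) + real (card ?L)"
    by (simp only: of_nat_add)
  also have "real (nat \<lfloor>?s\<rfloor>) \<le> ?s" by simp
  also have "real (card ?L) * (ln (real n) / 2) = (\<Sum>p\<in>?L. ln ?s)"
    using assms by (simp add: ln_sqrt)
  also have "\<dots> \<le> (\<Sum>p\<in>?L. ln (real p) * 1)"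
    using assms by (intro sum_mono) (auto simp: less_imp_le)
  also have "\<dots> \<le> (\<Sum>p\<in>{p\<in>{1..n}. prime p}. ln (real p) * 1)"
    by (intro sum_mono2) auto
  also have "\<dots> \<le> (\<Sum>m\<in>{1..n}. mangoldt m * 1)"
    by (rule prime_mangoldt_sum_le) auto
  also have "\<dots> \<le> 4 * real n" using psi_le[of n] by (simp add: psi_def)
  finally have L: "real (card ?L) \<le> 8 * real n / ln (real n)"
    using ln_pos by (simp add: field_simps)
  have "ln ?s \<le> ?s" using assms by (intro ln_bound) auto
  then have "?s * ln (real n) \<le> ?s * (2 * ?s)"
    using assms by (intro mult_left_mono) (auto simp: ln_sqrt)
  also have "?s * (2 * ?s) = 2 * real n" by (simp add: mult.left_commute)
  finally have "?s \<le> 2 * real n / ln (real n)"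
    using ln_pos by (simp only: pos_le_divide_eq)
  moreover have "10 * real n / ln (real n) = 2 * real n / ln (real n) + 8 * real n / ln (real n)"
    by (simp flip: add_divide_distrib)
  ultimately show ?thesis
    using L \<open>real (card {p\<in>{1..n}. prime p}) \<le> real (nat \<lfloor>?s\<rfloor>) + real (card ?L)\<close> \<open>real (nat \<lfloor>?s\<rfloor>) \<le> ?s\<close>
    by linarith
qed

lemma sum_mangoldt_over_square_le:
  assumes "u > 0" "u \<le> M"
  shows "(\<Sum>m\<in>{u<..M}. mangoldt m * (1 / real m ^ 2)) \<le> 12 / real u"
proof -
  \<comment> \<open>Summation by parts in inductive form: \<open>psi M / real M ^ 2\<close> is the
    boundary term, and \<open>psi_le\<close> bounds the remaining sum by 8 times the telescoping sum
    of 1/m - 1/(m + 1).\<close>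
  have "(\<Sum>m\<in>{u<..M}. mangoldt m * (1 / real m ^ 2)) \<le> psi M / real M ^ 2 + 8 * (1 / real u - 1 / real M)"
    using \<open>u \<le> M\<close>
  proof (induction M rule: dec_induct)
    case base
    have "psi u \<ge> 0" unfolding psi_def by (intro sum_nonneg mangoldt_nonneg)
    then show ?case by simp
  next
    case (step M)
    have "real M > 0" using assms step by simp
    have "{u<..Suc M} = insert (Suc M) {u<..M}" using step by auto
    then have S: "(\<Sum>m\<in>{u<..Suc M}. mangoldt m * (1 / real m ^ 2)) =
      (\<Sum>m\<in>{u<..M}. mangoldt m * (1 / real m ^ 2)) + mangoldt (Suc M) * (1 / real (Suc M) ^ 2)"
      by simp
    have P: "psi (Suc M) = psi M + mangoldt (Suc M)" by (simp add: psi_def)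
    have "psi M * (1 / real M ^ 2 - 1 / real (Suc M) ^ 2) \<le> 4 * real M * (1 / real M ^ 2 - 1 / real (Suc M) ^ 2)"
      using psi_le[of M] \<open>real M > 0\<close> by (intro mult_right_mono) (auto intro!: frac_le power_mono)
    also have "\<dots> \<le> 8 * (1 / real M - 1 / real (Suc M))"
    proof -
      define x where "x = real M"
      have "1 / x ^ 2 - 1 / (x + 1) ^ 2 = (2 * x + 1) / (x ^ 2 * (x + 1) ^ 2)"
        using \<open>real M > 0\<close> by (simp add: x_def field_simps) (simp add: power2_eq_square algebra_simps)?
      then have "4 * x * (1 / x ^ 2 - 1 / (x + 1) ^ 2) = 4 * (2 * x + 1) / (x * (x + 1) ^ 2)"
        using \<open>real M > 0\<close> by (simp add: x_def power2_eq_square)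
      also have "\<dots> \<le> 8 * (x + 1) / (x * (x + 1) ^ 2)"
        using \<open>real M > 0\<close> by (intro divide_right_mono) (auto simp: x_def)
      also have "\<dots> = 8 * (1 / x - 1 / (x + 1))"
      proof -
        have "x > 0" using \<open>real M > 0\<close> by (simp add: x_def)
        then have "1 / x - 1 / (x + 1) = 1 / (x * (x + 1))" by (simp add: field_simps)
        moreover have "8 * (x + 1) / (x * (x + 1) ^ 2) = 8 * (1 / (x * (x + 1)))"
          using \<open>x > 0\<close> by (simp only: power2_eq_square mult.assoc[symmetric] mult_divide_mult_cancel_right)
        ultimately show ?thesis by simp
      qed
      finally show ?thesis by (simp add: x_def add.commute)
    qed
    finally show ?case using step.IH unfolding S P by (simp add: algebra_simps add_divide_distrib)
  qed
  also have "psi M / real M ^ 2 \<le> 4 * real M / real M ^ 2"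
    using psi_le by (intro divide_right_mono) auto
  also have "4 * real M / real M ^ 2 + 8 * (1 / real u - 1 / real M) \<le> 12 / real u"
  proof -
    define a b where "a = inverse (real M)" and "b = inverse (real u)"
    have "0 \<le> a" "a \<le> b" using assms by (auto simp: a_def b_def)
    then have "4 * a + 8 * (b - a) \<le> 12 * b" by simp
    moreover have "4 * real M / real M ^ 2 = 4 * a" using assms by (simp add: power2_eq_square a_def field_simps)
    ultimately show ?thesis by (simp add: a_def b_def divide_inverse)
  qed
  finally show ?thesis by simp
qed

text \<open>Every prime of the range has \<open>mangoldt\<close> weight at least ln u; dividing by
  it gains the factor 1 / ln u over the tail of the sum over all integers.\<close>

lemma sum_primes_inverse_square_tail_le:
  assumes "u \<ge> 2"
  shows "(\<Sum>p\<in>{p\<in>{u<..M}. prime p}. 1 / real p ^ 2) \<le> 12 / (real u * ln (real u))"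
proof (cases "u \<le> M")
  case True
  have "ln (real u) * (\<Sum>p\<in>{p\<in>{u<..M}. prime p}. 1 / real p ^ 2) \<le> (\<Sum>p\<in>{p\<in>{u<..M}. prime p}. ln (real p) * (1 / real p ^ 2))"
    unfolding sum_distrib_left using assms by (intro sum_mono mult_right_mono) auto
  also have "\<dots> \<le> (\<Sum>m\<in>{u<..M}. mangoldt m * (1 / real m ^ 2))"
    by (rule prime_mangoldt_sum_le) auto
  also have "\<dots> \<le> 12 / real u" using assms True by (intro sum_mangoldt_over_square_le) auto
  finally show ?thesis using assms by (simp add: field_simps)
qed (use assms in simp)

section \<open>The Gauss map's transfer operator\<close>

text \<open>With h(x) = 1 / (1 + x), the Gauss density up to a constant, this is h(1/(x+m)) /
  ((x+m)^2 h(x)): the conditional probability under the Gauss measure that the first digit is m,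
  given that the Gauss map leads to x.\<close>

definition cf_prob :: "nat \<Rightarrow> real \<Rightarrow> real" where
  "cf_prob m x = (1 + x) / ((x + real m) * (x + real m + 1))"

text \<open>The transfer operator normalised by the Gauss density, that is, the conditional
  expectation of f over the preimages of x. It is dual to composition with \<open>gauss_map\<close>
  (\<open>nn_integral_gauss_transfer\<close>), and it fixes constants because the weights sum to
  1.\<close>

definition transfer :: "(real \<Rightarrow> real) \<Rightarrow> real \<Rightarrow> real" where
  "transfer f x = (\<Sum>i. cf_prob (Suc i) x * f (1 / (x + real (Suc i))))"

lemma cf_prob_nonneg: "x \<ge> 0 \<Longrightarrow> cf_prob m x \<ge> 0"
  by (simp add: cf_prob_def)

lemma cf_prob_telescope:
  assumes "x \<ge> 0"
  shows "cf_prob (Suc i) x = (1 + x) / (x + real i + 1) - (1 + x) / (x + real i + 2)"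
  using assms by (simp add: cf_prob_def divide_simps) (simp add: algebra_simps)

lemma sum_cf_prob:
  assumes "x \<ge> 0"
  shows "(\<Sum>i<n. cf_prob (Suc i) x) = 1 - (1 + x) / (x + real n + 1)"
  using assms by (induction n) (auto simp: cf_prob_telescope add_ac)

lemma sums_cf_prob:
  assumes "x \<ge> 0"
  shows "(\<lambda>i. cf_prob (Suc i) x) sums 1"
  unfolding sums_def sum_cf_prob[OF assms] by real_asymp

lemma inverse_branch_mem: "x \<ge> 0 \<Longrightarrow> 1 / (x + real (Suc i)) \<in> {0..1::real}"
  by (auto simp: divide_simps)

lemma transfer_cong:
  assumes "x \<ge> 0" "\<And>y. y \<in> {0..1} \<Longrightarrow> f y = g y"
  shows "transfer f x = transfer g x"
  unfolding transfer_def using inverse_branch_mem[OF assms(1)] assms(2) by simp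

lemma summable_transfer:
  assumes "x \<ge> 0" "\<And>y. y \<in> {0..1} \<Longrightarrow> \<bar>f y\<bar> \<le> B"
  shows "summable (\<lambda>i. cf_prob (Suc i) x * f (1 / (x + real (Suc i))))"
proof (rule summable_comparison_test)
  show "summable (\<lambda>i. cf_prob (Suc i) x * B)"
    using sums_cf_prob[OF assms(1)] by (intro summable_mult2) (auto simp: sums_iff)
  show "\<exists>N. \<forall>n\<ge>N. norm (cf_prob (Suc n) x * f (1 / (x + real (Suc n)))) \<le> cf_prob (Suc n) x * B"
    using assms(2)[OF inverse_branch_mem[OF assms(1)]] cf_prob_nonneg[OF assms(1)]
    by (auto simp: abs_mult intro!: mult_left_mono)
qed

lemma transfer_bounds:
  assumes "x \<ge> 0" "\<And>y. y \<in> {0..1} \<Longrightarrow> a \<le> f y" "\<And>y. y \<in> {0..1} \<Longrightarrow> f y \<le> b"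
  shows "a \<le> transfer f x" "transfer f x \<le> b"
proof -
  have s: "summable (\<lambda>i. cf_prob (Suc i) x * f (1 / (x + real (Suc i))))"
  proof (rule summable_transfer[OF assms(1)])
    fix y :: real assume "y \<in> {0..1}"
    then show "\<bar>f y\<bar> \<le> max \<bar>a\<bar> \<bar>b\<bar>" using assms(2,3)[of y] by auto
  qed
  have c: "(\<lambda>i. cf_prob (Suc i) x * c) sums c" for c
    using sums_mult2[OF sums_cf_prob[OF assms(1)], of c] by simp
  show "a \<le> transfer f x"
    unfolding transfer_def using c[of a] s
    by (rule sums_le[OF _ _ summable_sums, rotated 1])
       (intro mult_left_mono assms inverse_branch_mem cf_prob_nonneg)
  show "transfer f x \<le> b"
    unfolding transfer_def using summable_sums[OF s] c[of b]
    by (rule sums_le[rotated 1]) (intro mult_left_mono assms inverse_branch_mem cf_prob_nonneg)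
qed

lemma transfer_uminus:
  assumes "x \<ge> 0" "\<And>y. y \<in> {0..1} \<Longrightarrow> \<bar>f y\<bar> \<le> B"
  shows "transfer (\<lambda>x. - f x) x = - transfer f x"
  unfolding transfer_def using suminf_minus[OF summable_transfer[of x f B]] assms by simp

section \<open>Monotone functions under the transfer operator, and contraction of their
  oscillation\<close>

lemma abel_sum_nonneg:
  fixes d c :: "nat \<Rightarrow> real"
  assumes "\<And>n. (\<Sum>i<n. d i) \<ge> 0" "\<And>i. c (Suc i) \<le> c i" "\<And>i. c i \<ge> 0"
  shows "(\<Sum>i<n. d i * c i) \<ge> 0"
proof -
  have "(\<Sum>i<n. d i * c i) \<ge> (\<Sum>i<n. d i) * c n"
  proof (induction n)
    case (Suc n)
    have "(\<Sum>i<Suc n. d i) * c (Suc n) \<le> (\<Sum>i<Suc n. d i) * c n"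
      using assms by (intro mult_left_mono)
    with Suc show ?case by (simp add: algebra_simps)
  qed simp
  moreover have "(\<Sum>i<n. d i) * c n \<ge> 0" using assms by (intro mult_nonneg_nonneg)
  ultimately show ?thesis by linarith
qed

lemma mono_on_unit_bounds:
  fixes f :: "real \<Rightarrow> real"
  assumes "mono_on {0..1} f" "y \<in> {0..1}"
  shows "f 0 \<le> f y" "f y \<le> f 1"
  using assms by (auto intro: mono_onD)

text \<open>As \<open>x\<close> grows, the branches \<open>1/(x+m)\<close> decrease and \<open>cf_prob\<close> shifts mass to larger \<open>m\<close>,
  so the transition law is stochastically decreasing in \<open>x\<close>.\<close>

lemma transfer_mono_on:
  assumes f: "mono_on {0..1} f"
  shows "mono_on {0..1} (\<lambda>x. - transfer f x)"
proof (rule mono_onI)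
  fix x y :: real assume "x \<in> {0..1}" "y \<in> {0..1}" and xy: "x \<le> y"
  then have x: "x \<ge> 0" and y: "y \<ge> 0" by auto
  have B: "\<bar>f z\<bar> \<le> max \<bar>f 0\<bar> \<bar>f 1\<bar>" if "z \<in> {0..1}" for z
    using mono_on_unit_bounds[OF f that] by linarith
  \<comment> \<open>The branches are frozen at x, so that only the weights remain to be compared.
    Subtracting \<open>f 0\<close> makes the values nonnegative, as \<open>abel_sum_nonneg\<close>
    requires.\<close>
  define c where "c = (\<lambda>i. f (1 / (x + real (Suc i))) - f 0)"
  have cB: "c i \<le> f 1 - f 0" "c i \<ge> 0" for i
    using mono_on_unit_bounds[OF f inverse_branch_mem[OF x, of i]] by (auto simp: c_def)
  have s: "summable (\<lambda>i. cf_prob (Suc i) z * c i)" if "z \<ge> 0" for z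
  proof (rule summable_comparison_test)
    show "summable (\<lambda>i. cf_prob (Suc i) z * (f 1 - f 0))"
      using sums_cf_prob[OF that] by (intro summable_mult2) (auto simp: sums_iff)
    show "\<exists>N. \<forall>n\<ge>N. norm (cf_prob (Suc n) z * c n) \<le> cf_prob (Suc n) z * (f 1 - f 0)"
      using cB cf_prob_nonneg[OF that] by (auto simp: abs_mult intro!: mult_left_mono)
  qed
  have split: "transfer g z = (\<Sum>i. cf_prob (Suc i) z * (g (1 / (z + real (Suc i))) - f 0)) + f 0"
    if "z \<ge> 0" "mono_on {0..1} g" for g z
  proof -
    have "\<bar>g u\<bar> \<le> max \<bar>g 0\<bar> \<bar>g 1\<bar>" if "u \<in> {0..1}" for u
      using mono_on_unit_bounds[OF \<open>mono_on {0..1} g\<close> that] by linarith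
    from summable_transfer[OF that(1) this]
    have "(\<lambda>i. cf_prob (Suc i) z * g (1 / (z + real (Suc i))) - cf_prob (Suc i) z * f 0) sums (transfer g z - 1 * f 0)"
      unfolding transfer_def by (intro sums_diff sums_mult2 sums_cf_prob that summable_sums)
    then show ?thesis by (simp add: sums_iff right_diff_distrib)
  qed
  have "transfer f y - f 0 = (\<Sum>i. cf_prob (Suc i) y * (f (1 / (y + real (Suc i))) - f 0))"
    using split[OF y f] by simp
  also have "\<dots> \<le> (\<Sum>i. cf_prob (Suc i) y * c i)"
  proof (intro suminf_le s y mult_left_mono cf_prob_nonneg)
    fix i
    show "f (1 / (y + real (Suc i))) - f 0 \<le> c i"
      unfolding c_def using x y xy inverse_branch_mem[of x i] inverse_branch_mem[of y i]
      by (auto intro!: mono_onD[OF f] frac_le)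
    show "summable (\<lambda>i. cf_prob (Suc i) y * (f (1 / (y + real (Suc i))) - f 0))"
      by (rule summable_transfer[where B = "f 1 - f 0"]) (use y mono_on_unit_bounds[OF f] in auto)
  qed
  also have "\<dots> \<le> (\<Sum>i. cf_prob (Suc i) x * c i)"
  proof -
    have "0 \<le> (\<Sum>i<n. (cf_prob (Suc i) x - cf_prob (Suc i) y) * c i)" for n
    proof (rule abel_sum_nonneg)
      fix n
      \<comment> \<open>This quotient is the mass of the digits above n, by
        \<open>sum_cf_prob\<close>; it increases with x.\<close>
      have "(1 + x) / (x + real n + 1) \<le> (1 + y) / (y + real n + 1)"
        using x y mult_right_mono[OF xy, of "real n"] by (simp add: divide_simps) (simp add: algebra_simps)
      then show "0 \<le> (\<Sum>i<n. cf_prob (Suc i) x - cf_prob (Suc i) y)"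
        unfolding sum_subtractf sum_cf_prob[OF x] sum_cf_prob[OF y] by simp
    next
      fix i
      show "c (Suc i) \<le> c i"
        unfolding c_def using x inverse_branch_mem[of x i] inverse_branch_mem[of x "Suc i"]
        by (auto intro!: mono_onD[OF f] frac_le)
    qed (rule cB)
    then have "(\<Sum>i<n. cf_prob (Suc i) y * c i) \<le> (\<Sum>i<n. cf_prob (Suc i) x * c i)" for n
      by (simp add: left_diff_distrib sum_subtractf)
    then show ?thesis
      using summable_LIMSEQ[OF s[OF y]] summable_LIMSEQ[OF s[OF x]] LIMSEQ_le by blast
  qed
  also have "\<dots> = transfer f x - f 0"
    using split[OF x f] by (simp add: c_def)
  finally show "- transfer f x \<le> - transfer f y" by simp
qed

text \<open>The branches at 0 with m >= 2 are the branches at 1 with index m - 1, and they carry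
  half the weight. The branch m = 1 at 0 leads to the point 1 with weight 1/2. Hence
  \<open>transfer f 0\<close> is the midpoint of \<open>transfer f 1\<close> and \<open>f 1\<close>,
  and the factor 1/2 is this midpoint.\<close>

lemma transfer_osc:
  assumes f: "mono_on {0..1} f"
  shows "transfer f 0 - transfer f 1 \<le> (f 1 - f 0) / 2"
proof -
  have B: "\<bar>f z\<bar> \<le> max \<bar>f 0\<bar> \<bar>f 1\<bar>" if "z \<in> {0..1}" for z
    using mono_on_unit_bounds[OF f that] by linarith
  have "transfer f 0 = (\<Sum>i. cf_prob (Suc (Suc i)) 0 * f (1 / (0 + real (Suc (Suc i))))) + cf_prob (Suc 0) 0 * f (1 / (0 + real (Suc 0)))"
    unfolding transfer_def using summable_transfer[of 0 f, OF _ B]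
    by (subst suminf_split_head) auto
  also have "(\<Sum>i. cf_prob (Suc (Suc i)) 0 * f (1 / (0 + real (Suc (Suc i))))) =
     (\<Sum>i. (cf_prob (Suc i) 1 * f (1 / (1 + real (Suc i)))) * (1 / 2))"
    by (intro suminf_cong) (simp add: cf_prob_def add_ac)
  also have "\<dots> = transfer f 1 * (1 / 2)"
    unfolding transfer_def by (rule suminf_mult2[symmetric]) (use summable_transfer[of 1 f, OF _ B] in auto)
  also have "cf_prob (Suc 0) 0 * f (1 / (0 + real (Suc 0))) = f 1 / 2"
    by (simp add: cf_prob_def)
  finally have "transfer f 0 - transfer f 1 = (f 1 - transfer f 1) / 2" by simp
  moreover have "f 0 \<le> transfer f 1"
    using mono_on_unit_bounds[OF f] by (intro transfer_bounds(1)[where b = "f 1"]) auto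
  ultimately show ?thesis by simp
qed

lemma transfer_pow_bounds:
  assumes "\<And>y. y \<in> {0..1} \<Longrightarrow> a \<le> f y" "\<And>y. y \<in> {0..1} \<Longrightarrow> f y \<le> b" "x \<in> {0..1}"
  shows "a \<le> (transfer ^^ d) f x \<and> (transfer ^^ d) f x \<le> b"
  using assms(3)
proof (induction d arbitrary: x)
  case (Suc d)
  then show ?case using transfer_bounds[of x a "(transfer ^^ d) f" b] by auto
qed (use assms in auto)

text \<open>Each application reverses the direction of monotonicity, hence the disjunction. For a
  monotone function the difference of the endpoint values is the whole oscillation.\<close>

lemma transfer_pow_monotone:
  assumes "mono_on {0..1} f"
  shows "(mono_on {0..1} ((transfer ^^ d) f) \<or> mono_on {0..1} (\<lambda>x. - (transfer ^^ d) f x)) \<and>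
    \<bar>(transfer ^^ d) f 1 - (transfer ^^ d) f 0\<bar> \<le> (f 1 - f 0) / 2 ^ d"
proof (induction d)
  case 0
  show ?case using assms mono_on_unit_bounds[OF assms, of 1] by auto
next
  case (Suc d)
  let ?g = "(transfer ^^ d) f"
  from Suc have g: "mono_on {0..1} ?g \<or> mono_on {0..1} (\<lambda>x. - ?g x)" by blast
  have step: "mono_on {0..1} (\<lambda>x. - transfer g x) \<and> \<bar>transfer g 1 - transfer g 0\<bar> \<le> \<bar>g 1 - g 0\<bar> / 2"
    if "mono_on {0..1} g" for g
    using transfer_osc[OF that] mono_on_unit_bounds[OF that, of 1] transfer_mono_on[OF that]
      mono_on_unit_bounds[OF transfer_mono_on[OF that], of 1] by auto
  have "(mono_on {0..1} (transfer ?g) \<or> mono_on {0..1} (\<lambda>x. - transfer ?g x)) \<and>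
      \<bar>transfer ?g 1 - transfer ?g 0\<bar> \<le> \<bar>?g 1 - ?g 0\<bar> / 2"
    using g
  proof
    assume "mono_on {0..1} ?g"
    from step[OF this] show ?thesis by blast
  next
    assume *: "mono_on {0..1} (\<lambda>x. - ?g x)"
    have "\<bar>?g z\<bar> \<le> max \<bar>?g 0\<bar> \<bar>?g 1\<bar>" if "z \<in> {0..1}" for z
      using mono_on_unit_bounds[OF * that] by linarith
    then have eq: "transfer (\<lambda>x. - ?g x) x = - transfer ?g x" if "x \<in> {0..1}" for x
      using that by (intro transfer_uminus) auto
    have "mono_on {0..1} (transfer ?g)"
      using step[OF *] eq by (auto simp: mono_on_def)
    with step[OF *] eq[of 0] eq[of 1] show ?thesis by (auto simp: abs_minus_commute)
  qed
  moreover have "\<bar>?g 1 - ?g 0\<bar> / 2 \<le> (f 1 - f 0) / 2 ^ d / 2"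
    using Suc by (intro divide_right_mono) auto
  moreover have "(f 1 - f 0) / 2 ^ d / 2 = (f 1 - f 0) / 2 ^ Suc d"
    by (simp only: divide_divide_eq_left power_Suc2)
  ultimately show ?case unfolding funpow.simps o_apply by linarith
qed

lemma transfer_pow_osc:
  assumes "mono_on {0..1} f \<or> mono_on {0..1} (\<lambda>x. - f x)" "x \<in> {0..1}" "y \<in> {0..1}"
  shows "\<bar>(transfer ^^ d) f x - (transfer ^^ d) f y\<bar> \<le> \<bar>f 1 - f 0\<bar> / 2 ^ d"
proof -
  have main: "\<bar>(transfer ^^ d) f x - (transfer ^^ d) f y\<bar> \<le> \<bar>f 1 - f 0\<bar> / 2 ^ d" if f: "mono_on {0..1} f" for f
  proof -
    let ?g = "(transfer ^^ d) f"
    have 1: "\<bar>?g 1 - ?g 0\<bar> \<le> \<bar>f 1 - f 0\<bar> / 2 ^ d"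
      using transfer_pow_monotone[OF f, of d] mono_on_unit_bounds[OF f, of 1] by auto
    have "mono_on {0..1} ?g \<or> mono_on {0..1} (\<lambda>x. - ?g x)" using transfer_pow_monotone[OF f] by blast
    then have "\<bar>?g x - ?g y\<bar> \<le> \<bar>?g 1 - ?g 0\<bar>"
    proof
      assume "mono_on {0..1} ?g"
      then show ?thesis using mono_on_unit_bounds[of ?g x] mono_on_unit_bounds[of ?g y] assms by auto
    next
      assume "mono_on {0..1} (\<lambda>x. - ?g x)"
      then show ?thesis using mono_on_unit_bounds[of "\<lambda>x. - ?g x" x] mono_on_unit_bounds[of "\<lambda>x. - ?g x" y] assms by auto
    qed
    with 1 show ?thesis by linarith
  qed
  from assms(1) show ?thesis
  proof
    assume "mono_on {0..1} f"
    then show ?thesis by (rule main)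
  next
    assume *: "mono_on {0..1} (\<lambda>x. - f x)"
    have B: "\<bar>f z\<bar> \<le> max \<bar>f 0\<bar> \<bar>f 1\<bar>" if "z \<in> {0..1}" for z
      using mono_on_unit_bounds[OF * that] by linarith
    have eq: "(transfer ^^ d) (\<lambda>x. - f x) z = - (transfer ^^ d) f z" if "z \<in> {0..1}" for z
      using that
    proof (induction d arbitrary: z)
      case (Suc d)
      have "transfer ((transfer ^^ d) (\<lambda>x. - f x)) z = transfer (\<lambda>x. - (transfer ^^ d) f x) z"
        using Suc by (intro transfer_cong) auto
      also have "\<dots> = - transfer ((transfer ^^ d) f) z"
      proof (rule transfer_uminus)
        fix y :: real assume "y \<in> {0..1}"
        then show "\<bar>(transfer ^^ d) f y\<bar> \<le> max \<bar>f 0\<bar> \<bar>f 1\<bar>"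
          using transfer_pow_bounds[of "- max \<bar>f 0\<bar> \<bar>f 1\<bar>" f "max \<bar>f 0\<bar> \<bar>f 1\<bar>" y d] B by (force simp: abs_le_iff)
      qed (use Suc in auto)
      finally show ?case by simp
    qed simp
    have "\<bar>- (transfer ^^ d) f x - - (transfer ^^ d) f y\<bar> \<le> \<bar>- f 1 - - f 0\<bar> / 2 ^ d"
      using main[OF *] unfolding eq[OF assms(2)] eq[OF assms(3)] .
    moreover have "\<bar>- f 1 - - f 0\<bar> = \<bar>f 1 - f 0\<bar>" by simp
    ultimately show ?thesis by (metis abs_minus_cancel minus_diff_minus)
  qed
qed

section \<open>The Gauss measure\<close>

definition gauss_measure :: "real measure" where
  "gauss_measure = density lborel (\<lambda>x. ennreal (indicator {0<..1} x / (ln 2 * (1 + x))))"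

lemma sets_gauss_measure [measurable_cong, simp]: "sets gauss_measure = sets borel"
  by (simp add: gauss_measure_def)

lemma space_gauss_measure [simp]: "space gauss_measure = UNIV"
  by (simp add: gauss_measure_def)

lemma AE_gauss_measure_iff:
  "(AE x in gauss_measure. P x) \<longleftrightarrow> (AE x in lborel. x \<in> {0<..1} \<longrightarrow> P x)"
proof -
  have "0 < ennreal (indicator {0<..1} x / (ln 2 * (1 + x))) \<longleftrightarrow> x \<in> {0<..1}" for x :: real
    by (auto simp: indicator_def)
  then show ?thesis
    unfolding gauss_measure_def by (subst AE_density) auto
qed

lemma AE_gauss_measure_mem: "AE x in gauss_measure. x \<in> {0<..<1}"
  unfolding AE_gauss_measure_iff using AE_lborel_singleton[of "1::real"] by eventually_elim auto

lemma nn_integral_gauss_measure: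
  assumes [measurable]: "f \<in> borel_measurable borel"
  shows "(\<integral>\<^sup>+x. ennreal (f x) \<partial>gauss_measure) = (\<integral>\<^sup>+x. ennreal (f x / (ln 2 * (1 + x))) * indicator {0..1} x \<partial>lborel)"
proof -
  have "(\<integral>\<^sup>+x. ennreal (f x) \<partial>gauss_measure) =
      (\<integral>\<^sup>+x. ennreal (indicator {0<..1} x / (ln 2 * (1 + x))) * ennreal (f x) \<partial>lborel)"
    unfolding gauss_measure_def by (subst nn_integral_density) auto
  also have "\<dots> = (\<integral>\<^sup>+x. ennreal (f x / (ln 2 * (1 + x))) * indicator {0..1} x \<partial>lborel)"
    using AE_lborel_singleton[of "0::real"]
    by (intro nn_integral_cong_AE, eventually_elim)
       (auto simp: indicator_def simp flip: ennreal_mult')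
  finally show ?thesis .
qed

lemma prob_space_gauss_measure: "prob_space gauss_measure"
proof
  have "emeasure gauss_measure (space gauss_measure) = (\<integral>\<^sup>+x. ennreal 1 \<partial>gauss_measure)"
    by simp
  also have "\<dots> = (\<integral>\<^sup>+x. ennreal (1 / (ln 2 * (1 + x))) * indicator {0..1} x \<partial>lborel)"
    by (subst nn_integral_gauss_measure) auto
  also have "\<dots> = ennreal (ln (1 + 1) / ln 2 - ln (1 + 0) / ln 2)"
    by (intro nn_integral_FTC_Icc) (auto intro!: derivative_eq_intros)
  finally show "emeasure gauss_measure (space gauss_measure) = 1" by simp
qed

interpretation gauss: prob_space gauss_measure
  by (rule prob_space_gauss_measure)

lemma measurable_gauss_map [measurable]: "gauss_map \<in> borel_measurable borel"
  unfolding gauss_map_def frac_def by measurable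

lemma measurable_transfer [measurable]:
  assumes [measurable]: "f \<in> borel_measurable borel"
  shows "transfer f \<in> borel_measurable borel"
  unfolding transfer_def cf_prob_def by measurable

section \<open>Duality between the Gauss map and its transfer operator\<close>

lemma gauss_map_branch:
  assumes "x \<in> {1 / real (Suc (Suc i))<..1 / real (Suc i)}"
  shows "gauss_map x = 1 / x - real (Suc i)" "\<lfloor>1 / x\<rfloor> = int (Suc i)" "x > 0"
proof -
  have "0 < 1 / real (Suc (Suc i))" by simp
  moreover have "1 / real (Suc (Suc i)) < x" using assms by (simp only: greaterThanAtMost_iff)
  ultimately show x: "x > 0" by (rule less_trans)
  then show "\<lfloor>1 / x\<rfloor> = int (Suc i)"
    using assms by (intro floor_unique) (auto simp: field_simps)
  then show "gauss_map x = 1 / x - real (Suc i)"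
    using x by (simp add: gauss_map_def frac_def)
qed

text \<open>The substitution x = 1 / (y + i + 1) is decreasing, whereas
  \<open>nn_integral_substitution\<close> takes a nonnegative derivative. So x = 1 / (c - t) with c
  = i + 2 is substituted first, and t = 1 - y is a reflection afterwards.\<close>

lemma nn_integral_branch:
  assumes [measurable]: "h \<in> borel_measurable borel"
    and h: "\<And>x. x \<in> {0..1} \<Longrightarrow> h x \<ge> 0"
  shows "(\<integral>\<^sup>+x. ennreal (h x) * indicator {1 / real (Suc (Suc i))..1 / real (Suc i)} x \<partial>lborel) =
         (\<integral>\<^sup>+y. ennreal (h (1 / (y + real (Suc i))) / (y + real (Suc i)) ^ 2) * indicator {0..1} y \<partial>lborel)"
proof -
  define c where "c = real (Suc (Suc i))"
  have c: "c \<ge> 2" by (simp add: c_def)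
  have ivl: "{1 / real (Suc (Suc i))..1 / real (Suc i)} = {1 / (c - 0)..1 / (c - 1)}"
    by (simp add: c_def)
  have "(\<integral>\<^sup>+x. ennreal (h x) * indicator {1 / (c - 0)..1 / (c - 1)} x \<partial>lborel) =
        (\<integral>\<^sup>+x. ennreal (h x * indicator {1 / (c - 0)..1 / (c - 1)} x) \<partial>lborel)"
    by (intro nn_integral_cong) (auto simp: indicator_def)
  also have "\<dots> = (\<integral>\<^sup>+x. ennreal (h (1 / (c - x)) * (1 / (c - x) ^ 2) * indicator {0..1} x) \<partial>lborel)"
  proof (rule nn_integral_substitution)
    show "set_borel_measurable borel {1 / (c - 0)..1 / (c - 1)} h"
      unfolding set_borel_measurable_def by measurable
    show "((\<lambda>x. 1 / (c - x)) has_real_derivative 1 / (c - x) ^ 2) (at x)" if "x \<in> {0..1}" for x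
      using that c by (auto intro!: derivative_eq_intros simp: power2_eq_square)
    show "continuous_on {0..1} (\<lambda>x. 1 / (c - x) ^ 2)"
      using c by (intro continuous_intros) auto
  qed auto
  also have "\<dots> = ennreal \<bar>-1\<bar> * (\<integral>\<^sup>+x. ennreal (h (1 / (c - (1 + - 1 * x))) * (1 / (c - (1 + - 1 * x)) ^ 2) * indicator {0..1} (1 + - 1 * x)) \<partial>lborel)"
    by (rule nn_integral_real_affine) auto
  also have "\<dots> = (\<integral>\<^sup>+y. ennreal (h (1 / (y + real (Suc i))) / (y + real (Suc i)) ^ 2) * indicator {0..1} y \<partial>lborel)"
    by (simp, intro nn_integral_cong) (auto simp: indicator_def c_def algebra_simps)
  finally show ?thesis unfolding ivl .
qed

lemma unit_interval_branches:
  "{0<..1} = (\<Union>i. {1 / real (Suc (Suc i))<..1 / real (Suc i)})"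
proof (intro equalityI subsetI)
  fix x :: real assume x: "x \<in> {0<..1}"
  define m where "m = nat \<lfloor>1 / x\<rfloor>"
  have "1 / x \<ge> 1" using x by (auto simp: field_simps)
  then have "\<lfloor>1 / x\<rfloor> \<ge> 1" by simp
  then have m: "m \<ge> 1" "real m \<le> 1 / x" "1 / x < real m + 1"
    unfolding m_def by (linarith | simp)+
  then obtain i where i: "m = Suc i" by (cases m) auto
  have "x \<in> {1 / real (Suc (Suc i))<..1 / real (Suc i)}"
    using m x unfolding i by (auto simp: field_simps)
  then show "x \<in> (\<Union>i. {1 / real (Suc (Suc i))<..1 / real (Suc i)})" by blast
next
  fix x :: real assume "x \<in> (\<Union>i. {1 / real (Suc (Suc i))<..1 / real (Suc i)})"
  then obtain i where i: "x \<in> {1 / real (Suc (Suc i))<..1 / real (Suc i)}" by blast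
  have "1 / real (Suc i) \<le> 1" by simp
  moreover have "x \<le> 1 / real (Suc i)" using i by (simp only: greaterThanAtMost_iff)
  ultimately have "x \<le> 1" by linarith
  with gauss_map_branch(3)[OF i] show "x \<in> {0<..1}" by simp
qed

lemma disjoint_branches: "disjoint_family (\<lambda>i. {1 / real (Suc (Suc i))<..1 / real (Suc i)})"
  unfolding disjoint_family_on_def
proof (intro ballI impI, rule ccontr)
  fix m n :: nat
  assume "m \<noteq> n"
    and "{1 / real (Suc (Suc m))<..1 / real (Suc m)} \<inter> {1 / real (Suc (Suc n))<..1 / real (Suc n)} \<noteq> {}"
  then obtain x where "x \<in> {1 / real (Suc (Suc m))<..1 / real (Suc m)}" "x \<in> {1 / real (Suc (Suc n))<..1 / real (Suc n)}"
    by blast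
  from this[THEN gauss_map_branch(2)] \<open>m \<noteq> n\<close> show False by simp
qed

lemma gauss_map_mem: "gauss_map x \<in> {0..1}"
  by (auto simp: gauss_map_def frac_lt_1 less_imp_le)

text \<open>On each branch the Gauss map inverts y -> 1 / (y + i + 1). The Jacobian times the
  quotient of Gauss densities is exactly \<open>cf_prob (Suc i) y\<close>, so the changes of
  variables add up to \<open>transfer f\<close>.\<close>

lemma nn_integral_gauss_transfer:
  assumes [measurable]: "f \<in> borel_measurable borel" "g \<in> borel_measurable borel"
    and f: "\<And>x. x \<in> {0..1} \<Longrightarrow> 0 \<le> f x" "\<And>x. x \<in> {0..1} \<Longrightarrow> f x \<le> B"
    and g: "\<And>x. x \<in> {0..1} \<Longrightarrow> 0 \<le> g x"
  shows "(\<integral>\<^sup>+x. ennreal (f x * g (gauss_map x)) \<partial>gauss_measure) =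
         (\<integral>\<^sup>+x. ennreal (transfer f x * g x) \<partial>gauss_measure)"
proof -
  define I where "I = (\<lambda>i. {1 / real (Suc (Suc i))<..1 / real (Suc i)})"
  define F where "F = (\<lambda>x. f x * g (gauss_map x) / (ln 2 * (1 + x)))"
  have [measurable]: "F \<in> borel_measurable borel" unfolding F_def by measurable
  have "(\<integral>\<^sup>+x. ennreal (f x * g (gauss_map x)) \<partial>gauss_measure) = (\<integral>\<^sup>+x. ennreal (F x) * indicator {0..1} x \<partial>lborel)"
    unfolding F_def by (rule nn_integral_gauss_measure) measurable
  also have "\<dots> = (\<integral>\<^sup>+x. ennreal (F x) * (\<Sum>i. indicator (I i) x) \<partial>lborel)"
    using AE_lborel_singleton[of "0::real"]
  proof (intro nn_integral_cong_AE, eventually_elim)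
    fix x :: real assume "x \<noteq> 0"
    have "(\<Sum>i. indicator (I i) x) = (indicator {0<..1} x :: ennreal)"
      unfolding I_def unit_interval_branches by (rule suminf_indicator[OF disjoint_branches])
    then show "ennreal (F x) * indicator {0..1} x = ennreal (F x) * (\<Sum>i. indicator (I i) x)"
      using \<open>x \<noteq> 0\<close> by (auto simp: indicator_def)
  qed
  also have "\<dots> = (\<integral>\<^sup>+x. (\<Sum>i. ennreal (F x) * indicator (I i) x) \<partial>lborel)"
    by (simp add: ennreal_suminf_cmult)
  also have "\<dots> = (\<Sum>i. \<integral>\<^sup>+x. ennreal (F x) * indicator (I i) x \<partial>lborel)"
    by (intro nn_integral_suminf) (auto simp: I_def)
  also have "\<dots> = (\<Sum>i. \<integral>\<^sup>+y. ennreal (cf_prob (Suc i) y * f (1 / (y + real (Suc i))) * g y / (ln 2 * (1 + y))) * indicator {0..1} y \<partial>lborel)"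
  proof (intro suminf_cong)
    fix i
    define k where "k = real (Suc i)"
    have k: "k \<ge> 1" by (simp add: k_def)
    \<comment> \<open>The cut-off outside the branch matters: there \<open>1 / x - k\<close> leaves
      the unit interval, and \<open>g\<close> is known to be nonnegative only inside it.\<close>
    define h where "h = (\<lambda>x. if x \<in> {1 / real (Suc (Suc i))..1 / real (Suc i)} then f x * g (1 / x - k) / (ln 2 * (1 + x)) else 0)"
    have [measurable]: "h \<in> borel_measurable borel" unfolding h_def by measurable
    have "(\<integral>\<^sup>+x. ennreal (F x) * indicator (I i) x \<partial>lborel) =
       (\<integral>\<^sup>+x. ennreal (h x) * indicator {1 / real (Suc (Suc i))..1 / real (Suc i)} x \<partial>lborel)"
      using AE_lborel_singleton[of "1 / real (Suc (Suc i))"]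
    proof (intro nn_integral_cong_AE, eventually_elim)
      fix x :: real assume x: "x \<noteq> 1 / real (Suc (Suc i))"
      show "ennreal (F x) * indicator (I i) x = ennreal (h x) * indicator {1 / real (Suc (Suc i))..1 / real (Suc i)} x"
      proof (cases "x \<in> I i")
        case True
        then have "F x = h x"
          using gauss_map_branch(1)[of x i] by (auto simp: I_def F_def h_def k_def)
        with True show ?thesis by (auto simp: I_def simp del: of_nat_Suc)
      next
        case False
        with x show ?thesis by (auto simp: I_def indicator_def simp del: of_nat_Suc)
      qed
    qed
    also have "\<dots> = (\<integral>\<^sup>+y. ennreal (h (1 / (y + real (Suc i))) / (y + real (Suc i)) ^ 2) * indicator {0..1} y \<partial>lborel)"
    proof (rule nn_integral_branch)
      fix x :: real assume x: "x \<in> {0..1}"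
      show "0 \<le> h x"
      proof (cases "x \<in> {1 / real (Suc (Suc i))..1 / real (Suc i)}")
        case True
        have "0 < 1 / real (Suc (Suc i))" by simp
        moreover have "1 / real (Suc (Suc i)) \<le> x" using True by (simp only: atLeastAtMost_iff)
        ultimately have "x > 0" by (rule less_le_trans)
        then have "1 / x - k \<in> {0..1}" using True by (auto simp: k_def field_simps)
        then show ?thesis unfolding h_def using x by (auto intro!: f g divide_nonneg_nonneg mult_nonneg_nonneg)
      qed (auto simp: h_def)
    qed measurable
    also have "\<dots> = (\<integral>\<^sup>+y. ennreal (cf_prob (Suc i) y * f (1 / (y + real (Suc i))) * g y / (ln 2 * (1 + y))) * indicator {0..1} y \<partial>lborel)"
    proof (intro nn_integral_cong)
      fix y :: real
      show "ennreal (h (1 / (y + real (Suc i))) / (y + real (Suc i)) ^ 2) * indicator {0..1} y =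
        ennreal (cf_prob (Suc i) y * f (1 / (y + real (Suc i))) * g y / (ln 2 * (1 + y))) * indicator {0..1} y"
      proof (cases "y \<in> {0..1}")
        case True
        then have y: "0 \<le> y" "y \<le> 1" by auto
        have "1 / (y + k) \<in> {1 / real (Suc (Suc i))..1 / real (Suc i)}"
          using y by (auto simp: k_def intro!: frac_le)
        then have "h (1 / (y + k)) = f (1 / (y + k)) * g y / (ln 2 * (1 + 1 / (y + k)))"
          by (simp add: h_def)
        then have "h (1 / (y + k)) / (y + k) ^ 2 = f (1 / (y + k)) * g y / ln 2 * (1 / (1 + 1 / (y + k)) / (y + k) ^ 2)"
          by simp
        also have "1 / (1 + 1 / (y + k)) / (y + k) ^ 2 = cf_prob (Suc i) y / (1 + y)"
        proof -
          have "1 / (1 + 1 / (y + k)) = (y + k) / (y + k + 1)" using y k by (simp add: field_simps)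
          moreover have "cf_prob (Suc i) y = (1 + y) / ((y + k) * (y + k + 1))"
            by (simp add: cf_prob_def k_def)
          ultimately show ?thesis using y k by (simp add: power2_eq_square mult_ac)
        qed
        finally have "h (1 / (y + k)) / (y + k) ^ 2 = cf_prob (Suc i) y * f (1 / (y + k)) * g y / (ln 2 * (1 + y))"
          by (simp add: mult_ac)
        then show ?thesis by (simp add: k_def)
      qed simp
    qed
    finally show "(\<integral>\<^sup>+x. ennreal (F x) * indicator (I i) x \<partial>lborel) = \<dots>" .
  qed
  also have "\<dots> = (\<integral>\<^sup>+y. (\<Sum>i. ennreal (cf_prob (Suc i) y * f (1 / (y + real (Suc i))) * g y / (ln 2 * (1 + y))) * indicator {0..1} y) \<partial>lborel)"
    by (intro nn_integral_suminf[symmetric]) (auto simp: cf_prob_def)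
  also have "\<dots> = (\<integral>\<^sup>+y. ennreal (transfer f y * g y / (ln 2 * (1 + y))) * indicator {0..1} y \<partial>lborel)"
  proof (intro nn_integral_cong)
    fix y :: real
    show "(\<Sum>i. ennreal (cf_prob (Suc i) y * f (1 / (y + real (Suc i))) * g y / (ln 2 * (1 + y))) * indicator {0..1} y) =
      ennreal (transfer f y * g y / (ln 2 * (1 + y))) * indicator {0..1} y"
    proof (cases "y \<in> {0..1}")
      case True
      have "(\<lambda>i. cf_prob (Suc i) y * f (1 / (y + real (Suc i)))) sums transfer f y"
        unfolding transfer_def
        by (intro summable_sums summable_transfer[where B = B]) (use True f in auto)
      then have "(\<lambda>i. cf_prob (Suc i) y * f (1 / (y + real (Suc i))) * (g y / (ln 2 * (1 + y)))) sums (transfer f y * (g y / (ln 2 * (1 + y))))"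
        by (rule sums_mult2)
      then have s: "(\<lambda>i. cf_prob (Suc i) y * f (1 / (y + real (Suc i))) * g y / (ln 2 * (1 + y))) sums (transfer f y * g y / (ln 2 * (1 + y)))"
        by simp
      have "(\<Sum>i. ennreal (cf_prob (Suc i) y * f (1 / (y + real (Suc i))) * g y / (ln 2 * (1 + y)))) = ennreal (transfer f y * g y / (ln 2 * (1 + y)))"
      proof (rule suminf_ennreal_eq[OF _ s])
        fix i
        show "0 \<le> cf_prob (Suc i) y * f (1 / (y + real (Suc i))) * g y / (ln 2 * (1 + y))"
          using True g[of y] f(1)[OF inverse_branch_mem[of y i]]
          by (intro divide_nonneg_nonneg mult_nonneg_nonneg cf_prob_nonneg) auto
      qed
      with True show ?thesis by simp
    qed simp
  qed
  also have "\<dots> = (\<integral>\<^sup>+x. ennreal (transfer f x * g x) \<partial>gauss_measure)"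
    by (rule nn_integral_gauss_measure[symmetric]) measurable
  finally show ?thesis .
qed

lemma integrable_gauss_bounded:
  assumes [measurable]: "f \<in> borel_measurable borel"
    and "\<And>x. x \<in> {0..1} \<Longrightarrow> \<bar>f x\<bar> \<le> (B :: real)"
  shows "integrable gauss_measure f"
proof (rule gauss.integrable_const_bound[where B = B])
  show "AE x in gauss_measure. norm (f x) \<le> B"
    using assms(2) by (intro eventually_mono[OF AE_gauss_measure_mem]) auto
qed measurable

lemma integral_gauss_transfer:
  assumes [measurable]: "f \<in> borel_measurable borel" "g \<in> borel_measurable borel"
    and f: "\<And>x. x \<in> {0..1} \<Longrightarrow> 0 \<le> f x" "\<And>x. x \<in> {0..1} \<Longrightarrow> f x \<le> B"
    and g: "\<And>x. x \<in> {0..1} \<Longrightarrow> 0 \<le> g x"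
  shows "(\<integral>x. f x * g (gauss_map x) \<partial>gauss_measure) = (\<integral>x. transfer f x * g x \<partial>gauss_measure)"
proof -
  have "(\<integral>x. f x * g (gauss_map x) \<partial>gauss_measure) = enn2real (\<integral>\<^sup>+x. ennreal (f x * g (gauss_map x)) \<partial>gauss_measure)"
  proof (rule integral_eq_nn_integral)
    show "AE x in gauss_measure. 0 \<le> f x * g (gauss_map x)"
      using f g[OF gauss_map_mem] by (intro eventually_mono[OF AE_gauss_measure_mem]) auto
  qed measurable
  also have "\<dots> = enn2real (\<integral>\<^sup>+x. ennreal (transfer f x * g x) \<partial>gauss_measure)"
    using f g by (subst nn_integral_gauss_transfer[where B = B]) auto
  also have "\<dots> = (\<integral>x. transfer f x * g x \<partial>gauss_measure)"
  proof (intro integral_eq_nn_integral[symmetric])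
    show "AE x in gauss_measure. 0 \<le> transfer f x * g x"
      using AE_gauss_measure_mem
    proof eventually_elim
      fix x :: real assume "x \<in> {0<..<1}"
      then show "0 \<le> transfer f x * g x"
        using transfer_bounds(1)[of x 0 f B] f g[of x] by (auto intro!: mult_nonneg_nonneg)
    qed
  qed measurable
  finally show ?thesis .
qed

lemma cf_digit_conv: "k \<ge> 1 \<Longrightarrow> cf_digit k x = cf_digit 1 ((gauss_map ^^ (k - 1)) x)"
  by (simp add: cf_digit_def)

lemma cf_digit_1: "cf_digit 1 x = (if x = 0 then 0 else nat \<lfloor>1 / x\<rfloor>)"
  by (simp add: cf_digit_def)

lemma measurable_gauss_map_pow [measurable]: "(gauss_map ^^ n) \<in> borel_measurable borel"
  by (induction n) (auto simp: id_def comp_def)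

lemma measurable_cf_digit [measurable]: "cf_digit k \<in> measurable borel (count_space UNIV)"
  unfolding cf_digit_def Let_def by measurable

lemma gauss_map_pow_mem: "x \<in> {0..1} \<Longrightarrow> (gauss_map ^^ n) x \<in> {0..1}"
  using gauss_map_mem by (induction n) auto

text \<open>The endpoint 1 has to be excluded: there the point 1 / (x + i + 1) has digit i + 2. This
  is why identities between digits and branches are used for almost every x, through
  \<open>AE_gauss_measure_mem\<close>.\<close>

lemma cf_digit_inverse_branch:
  assumes "x \<in> {0<..<1}"
  shows "cf_digit 1 (1 / (x + real (Suc i))) = Suc i"
proof -
  have "\<lfloor>x + real (Suc i)\<rfloor> = int (Suc i)" using assms by (intro floor_unique) auto
  then show ?thesis using assms unfolding cf_digit_1 by simp
qed

lemma integral_gauss_cong: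
  assumes "f \<in> borel_measurable borel" "g \<in> borel_measurable borel"
    and "\<And>x. x \<in> {0<..<1} \<Longrightarrow> f x = (g x :: real)"
  shows "(\<integral>x. f x \<partial>gauss_measure) = (\<integral>x. g x \<partial>gauss_measure)"
  using assms by (intro integral_cong_AE eventually_mono[OF AE_gauss_measure_mem]) auto

lemma integral_gauss_mono:
  assumes "f \<in> borel_measurable borel" "g \<in> borel_measurable borel"
    and "\<And>x. x \<in> {0..1} \<Longrightarrow> \<bar>f x\<bar> \<le> (B :: real)" "\<And>x. x \<in> {0..1} \<Longrightarrow> \<bar>g x\<bar> \<le> (C :: real)"
    and "\<And>x. x \<in> {0<..<1} \<Longrightarrow> f x \<le> g x"
  shows "(\<integral>x. f x \<partial>gauss_measure) \<le> (\<integral>x. g x \<partial>gauss_measure)"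
  using assms integrable_gauss_bounded[OF assms(1,3)] integrable_gauss_bounded[OF assms(2,4)]
  by (intro integral_mono_AE eventually_mono[OF AE_gauss_measure_mem]) auto

text \<open>Invariance of the Gauss measure is duality applied to the constant 1, which
  \<open>transfer\<close> fixes.\<close>

lemma integral_gauss_map:
  fixes g :: "real \<Rightarrow> real"
  assumes [measurable]: "g \<in> borel_measurable borel" and g: "\<And>x. x \<in> {0..1} \<Longrightarrow> 0 \<le> g x"
  shows "(\<integral>x. g (gauss_map x) \<partial>gauss_measure) = (\<integral>x. g x \<partial>gauss_measure)"
proof -
  have "(\<integral>x. g (gauss_map x) \<partial>gauss_measure) = (\<integral>x. transfer (\<lambda>_. 1) x * g x \<partial>gauss_measure)"
    using integral_gauss_transfer[of "\<lambda>_. 1" g 1] g by simp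
  also have "\<dots> = (\<integral>x. g x \<partial>gauss_measure)"
  proof (rule integral_gauss_cong)
    fix x :: real assume "x \<in> {0<..<1}"
    then show "transfer (\<lambda>_. 1) x * g x = g x"
      using sums_cf_prob[of x] by (simp add: transfer_def sums_iff)
  qed measurable
  finally show ?thesis .
qed

lemma integral_gauss_map_pow:
  fixes g :: "real \<Rightarrow> real"
  assumes [measurable]: "g \<in> borel_measurable borel" and g: "\<And>x. x \<in> {0..1} \<Longrightarrow> 0 \<le> g x"
  shows "(\<integral>x. g ((gauss_map ^^ n) x) \<partial>gauss_measure) = (\<integral>x. g x \<partial>gauss_measure)"
proof (induction n)
  case (Suc n)
  have "(\<integral>x. g ((gauss_map ^^ Suc n) x) \<partial>gauss_measure) = (\<integral>x. g ((gauss_map ^^ n) (gauss_map x)) \<partial>gauss_measure)"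
    by (simp add: funpow_swap1)
  also have "\<dots> = (\<integral>x. g ((gauss_map ^^ n) x) \<partial>gauss_measure)"
    by (rule integral_gauss_map) (auto intro!: g gauss_map_pow_mem)
  finally show ?case using Suc by simp
qed simp

lemma measurable_transfer_pow [measurable]:
  fixes f :: "real \<Rightarrow> real"
  assumes "f \<in> borel_measurable borel"
  shows "(transfer ^^ d) f \<in> borel_measurable borel"
  using assms by (induction d) auto

lemma integral_gauss_transfer_pow:
  fixes f g :: "real \<Rightarrow> real"
  assumes "f \<in> borel_measurable borel" and [measurable]: "g \<in> borel_measurable borel"
    and "\<And>x. x \<in> {0..1} \<Longrightarrow> 0 \<le> f x" "\<And>x. x \<in> {0..1} \<Longrightarrow> f x \<le> B"
    and g: "\<And>x. x \<in> {0..1} \<Longrightarrow> 0 \<le> g x"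
  shows "(\<integral>x. f x * g ((gauss_map ^^ d) x) \<partial>gauss_measure) = (\<integral>x. (transfer ^^ d) f x * g x \<partial>gauss_measure)"
  using assms(1,3,4)
proof (induction d arbitrary: f)
  case (Suc d)
  note [measurable] = Suc.prems(1)
  have "(\<integral>x. f x * g ((gauss_map ^^ Suc d) x) \<partial>gauss_measure) =
     (\<integral>x. f x * g ((gauss_map ^^ d) (gauss_map x)) \<partial>gauss_measure)"
    by (simp add: funpow_swap1)
  also have "\<dots> = (\<integral>x. transfer f x * g ((gauss_map ^^ d) x) \<partial>gauss_measure)"
    by (rule integral_gauss_transfer[where B = B]) (use Suc.prems in \<open>auto intro!: g gauss_map_pow_mem\<close>)
  also have "\<dots> = (\<integral>x. (transfer ^^ d) (transfer f) x * g x \<partial>gauss_measure)"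
  proof (rule Suc.IH)
    fix x :: real assume "x \<in> {0..1}"
    then show "0 \<le> transfer f x" "transfer f x \<le> B"
      using transfer_bounds[of x 0 f B] Suc.prems by auto
  qed measurable
  finally show ?case by (simp add: funpow_swap1)
qed simp

text \<open>Duality moves the shift onto \<open>f\<close>, whose d-th iterate oscillates by at most
  \<open>\<bar>f 1 - f 0\<bar> / 2 ^ d\<close> and so stays that close to its mean, which is the
  mean of \<open>f\<close>. Integration against \<open>g\<close> makes the error proportional to the
  mean of \<open>g\<close> and not to its bound \<open>C\<close>.\<close>

lemma gauss_mixing_monotone:
  fixes f g :: "real \<Rightarrow> real"
  assumes [measurable]: "f \<in> borel_measurable borel" "g \<in> borel_measurable borel"
    and mono: "mono_on {0..1} f \<or> mono_on {0..1} (\<lambda>x. - f x)"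
    and f: "\<And>x. x \<in> {0..1} \<Longrightarrow> 0 \<le> f x" "\<And>x. x \<in> {0..1} \<Longrightarrow> f x \<le> B"
    and g: "\<And>x. x \<in> {0..1} \<Longrightarrow> 0 \<le> g x" "\<And>x. x \<in> {0..1} \<Longrightarrow> g x \<le> C"
  shows "\<bar>(\<integral>x. f x * g ((gauss_map ^^ d) x) \<partial>gauss_measure) - (\<integral>x. f x \<partial>gauss_measure) * (\<integral>x. g x \<partial>gauss_measure)\<bar>
    \<le> \<bar>f 1 - f 0\<bar> / 2 ^ d * (\<integral>x. g x \<partial>gauss_measure)"
proof -
  let ?h = "(transfer ^^ d) f"
  define K where "K = \<bar>f 1 - f 0\<bar> / 2 ^ d"
  have K0: "K \<ge> 0" by (simp add: K_def)
  define c where "c = (\<integral>x. f x \<partial>gauss_measure)"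
  have hB: "0 \<le> ?h x" "?h x \<le> B" if "x \<in> {0..1}" for x
    using transfer_pow_bounds[of 0 f B x d] f that by auto
  have int_h: "integrable gauss_measure ?h"
    using hB by (intro integrable_gauss_bounded[where B = B]) auto
  have int_g: "integrable gauss_measure g"
    using g by (intro integrable_gauss_bounded[where B = C]) auto
  have int_hg: "integrable gauss_measure (\<lambda>x. ?h x * g x)"
    using hB g by (intro integrable_gauss_bounded[where B = "B * C"]) (auto simp: abs_mult intro!: mult_mono intro: order_trans)
  have c: "c = (\<integral>x. ?h x \<partial>gauss_measure)"
    unfolding c_def using integral_gauss_transfer_pow[of f "\<lambda>_. 1" B d] f by simp
  have K: "\<bar>?h y - c\<bar> \<le> K" if "y \<in> {0..1}" for y
  proof -
    have "?h z \<le> ?h y + K \<and> ?h y - K \<le> ?h z" if "z \<in> {0<..<1}" for z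
      using transfer_pow_osc[OF mono, of z y d] that \<open>y \<in> {0..1}\<close> unfolding K_def by auto
    then have "c \<le> ?h y + K" "?h y - K \<le> c"
      unfolding c by (auto intro!: gauss.integral_le_const gauss.integral_ge_const int_h eventually_mono[OF AE_gauss_measure_mem])
    then show ?thesis by linarith
  qed
  have "(\<integral>x. f x * g ((gauss_map ^^ d) x) \<partial>gauss_measure) - c * (\<integral>x. g x \<partial>gauss_measure) = (\<integral>x. (?h x - c) * g x \<partial>gauss_measure)"
    using integral_gauss_transfer_pow[of f g B d] f g int_g int_hg by (simp add: left_diff_distrib)
  also have "\<bar>\<dots>\<bar> \<le> (\<integral>x. \<bar>(?h x - c) * g x\<bar> \<partial>gauss_measure)"
    by (rule integral_abs_bound)
  also have "\<dots> \<le> (\<integral>x. K * g x \<partial>gauss_measure)"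
  proof (rule integral_gauss_mono)
    fix x :: real assume x: "x \<in> {0..1}"
    have "\<bar>?h x - c\<bar> * g x \<le> K * C" "\<bar>K * g x\<bar> \<le> K * C"
      using K[OF x] g[OF x] K0 by (auto simp: abs_mult intro!: mult_mono)
    then show "\<bar>\<bar>(?h x - c) * g x\<bar>\<bar> \<le> K * C" "\<bar>K * g x\<bar> \<le> K * C"
      using g[OF x] by (auto simp: abs_mult)
  next
    fix x :: real assume "x \<in> {0<..<1}"
    then show "\<bar>(?h x - c) * g x\<bar> \<le> K * g x"
      using K[of x] g[of x] by (auto simp: abs_mult intro!: mult_right_mono)
  qed auto
  finally show ?thesis by (simp add: c_def K_def)
qed

section \<open>The distribution of a single digit\<close>

definition digit_ind :: "nat \<Rightarrow> real \<Rightarrow> real" where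
  "digit_ind m x = (if cf_digit 1 x = m then 1 else 0)"

lemma measurable_digit_ind [measurable]: "digit_ind m \<in> borel_measurable borel"
  unfolding digit_ind_def by measurable

lemma measurable_cf_prob [measurable]: "cf_prob m \<in> borel_measurable borel"
  unfolding cf_prob_def by measurable

lemma transfer_digit_ind:
  assumes "x \<in> {0<..<1}" "m \<ge> 1"
  shows "transfer (digit_ind m) x = cf_prob m x"
proof -
  obtain n where n: "m = Suc n" using assms(2) by (cases m) auto
  have "(\<lambda>i. cf_prob (Suc i) x * digit_ind m (1 / (x + real (Suc i)))) = (\<lambda>i. if i = n then cf_prob (Suc i) x else 0)"
    unfolding digit_ind_def cf_digit_inverse_branch[OF assms(1)] n by auto
  then show ?thesis
    unfolding transfer_def n using sums_single[of n "\<lambda>i. cf_prob (Suc i) x"] by (simp add: sums_iff)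
qed

lemma cf_prob_le:
  assumes "x \<in> {0..1}" "m \<ge> 1"
  shows "cf_prob m x \<le> (1 + x) / (real m * (real m + 1))" "cf_prob m x \<ge> (1 + x) / ((real m + 1) * (real m + 2))"
    "cf_prob m x \<le> 2 / (real m * (real m + 1))" "cf_prob m x \<le> 2"
proof -
  show 1: "cf_prob m x \<le> (1 + x) / (real m * (real m + 1))"
    unfolding cf_prob_def using assms by (intro divide_left_mono mult_mono) auto
  show "cf_prob m x \<ge> (1 + x) / ((real m + 1) * (real m + 2))"
    unfolding cf_prob_def using assms by (intro divide_left_mono mult_mono) auto
  have "(1 + x) / (real m * (real m + 1)) \<le> 2 / (real m * (real m + 1))"
    using assms by (intro divide_right_mono) auto
  with 1 show 2: "cf_prob m x \<le> 2 / (real m * (real m + 1))" by linarith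
  have "1 * 1 \<le> real m * (real m + 1)" using assms by (intro mult_mono) auto
  then have "2 / (real m * (real m + 1)) \<le> 2 / 1" by (intro divide_left_mono) auto
  with 2 show "cf_prob m x \<le> 2" by linarith
qed

lemma integral_digit_ind_gauss_map:
  fixes g :: "real \<Rightarrow> real"
  assumes [measurable]: "g \<in> borel_measurable borel" and g: "\<And>x. x \<in> {0..1} \<Longrightarrow> 0 \<le> g x"
    and m: "m \<ge> 1"
  shows "(\<integral>x. digit_ind m x * g (gauss_map x) \<partial>gauss_measure) = (\<integral>x. cf_prob m x * g x \<partial>gauss_measure)"
proof -
  have "(\<integral>x. digit_ind m x * g (gauss_map x) \<partial>gauss_measure) = (\<integral>x. transfer (digit_ind m) x * g x \<partial>gauss_measure)"
    by (rule integral_gauss_transfer[where B = 1]) (auto simp: digit_ind_def g)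
  also have "\<dots> = (\<integral>x. cf_prob m x * g x \<partial>gauss_measure)"
    using m by (intro integral_gauss_cong) (auto simp: transfer_digit_ind)
  finally show ?thesis .
qed

text \<open>The factor 1 + x cancels the Gauss density and leaves Lebesgue measure divided by ln 2.
  This is the source of the constant log 2 in the law.\<close>

lemma integral_one_plus_gauss: "(\<integral>x. 1 + x \<partial>gauss_measure) = 1 / ln 2"
proof -
  have "(\<integral>x. 1 + x \<partial>gauss_measure) = enn2real (\<integral>\<^sup>+x. ennreal (1 + x) \<partial>gauss_measure)"
    by (intro integral_eq_nn_integral eventually_mono[OF AE_gauss_measure_mem]) auto
  also have "(\<integral>\<^sup>+x. ennreal (1 + x) \<partial>gauss_measure) = (\<integral>\<^sup>+x. ennreal ((1 + x) / (ln 2 * (1 + x))) * indicator {0..1} x \<partial>lborel)"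
    by (rule nn_integral_gauss_measure) measurable
  also have "\<dots> = (\<integral>\<^sup>+x. ennreal (1 / ln 2) * indicator {0..1::real} x \<partial>lborel)"
    by (intro nn_integral_cong) (auto simp: indicator_def)
  also have "\<dots> = ennreal (1 / ln 2)"
    by (simp add: nn_integral_cmult_indicator)
  finally show ?thesis by simp
qed

text \<open>Integrating the bounds of \<open>cf_prob_le\<close> against the Gauss measure. The first
  two bounds have the exact leading constant 1 / ln 2, for the asymptotics of the mean; the third is
  a cruder one for the moment estimates.\<close>

lemma digit_prob_bounds:
  assumes "m \<ge> 1"
  shows "(\<integral>x. digit_ind m x \<partial>gauss_measure) \<le> 1 / ln 2 / (real m * (real m + 1))"
    "(\<integral>x. digit_ind m x \<partial>gauss_measure) \<ge> 1 / ln 2 / ((real m + 1) * (real m + 2))"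
    "(\<integral>x. digit_ind m x \<partial>gauss_measure) \<le> 2 / (real m * (real m + 1))"
proof -
  have eq: "(\<integral>x. digit_ind m x \<partial>gauss_measure) = (\<integral>x. cf_prob m x \<partial>gauss_measure)"
    using integral_digit_ind_gauss_map[of "\<lambda>_. 1" m] assms by simp
  have int: "integrable gauss_measure (cf_prob m)"
    by (rule integrable_gauss_bounded[where B = 2]) (auto simp: cf_prob_nonneg intro!: cf_prob_le assms)
  have int': "integrable gauss_measure (\<lambda>x. 1 + x)"
    by (rule integrable_gauss_bounded[where B = 2]) auto
  have "(\<integral>x. cf_prob m x \<partial>gauss_measure) \<le> (\<integral>x. (1 + x) / (real m * (real m + 1)) \<partial>gauss_measure)"
    using int int' cf_prob_le(1)[OF _ assms]
    by (intro integral_mono_AE eventually_mono[OF AE_gauss_measure_mem]) auto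
  also have "\<dots> = 1 / ln 2 / (real m * (real m + 1))"
    by (subst integral_divide_zero) (simp add: integral_one_plus_gauss)
  finally show "(\<integral>x. digit_ind m x \<partial>gauss_measure) \<le> 1 / ln 2 / (real m * (real m + 1))"
    unfolding eq .
  have "1 / ln 2 / ((real m + 1) * (real m + 2)) = (\<integral>x. (1 + x) / ((real m + 1) * (real m + 2)) \<partial>gauss_measure)"
    by (subst integral_divide_zero) (simp add: integral_one_plus_gauss)
  also have "\<dots> \<le> (\<integral>x. cf_prob m x \<partial>gauss_measure)"
    using int int' cf_prob_le(2)[OF _ assms]
    by (intro integral_mono_AE eventually_mono[OF AE_gauss_measure_mem]) auto
  finally show "(\<integral>x. digit_ind m x \<partial>gauss_measure) \<ge> 1 / ln 2 / ((real m + 1) * (real m + 2))"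
    unfolding eq .
  show "(\<integral>x. digit_ind m x \<partial>gauss_measure) \<le> 2 / (real m * (real m + 1))"
    unfolding eq using cf_prob_le(3)[OF _ assms]
    by (intro gauss.integral_le_const int eventually_mono[OF AE_gauss_measure_mem]) auto
qed

section \<open>Mixing and second moments\<close>

text \<open>\<open>cf_prob m\<close> is written as the difference of the monotone functions
  \<open>2 / ((x+m)(x+m+1))\<close> and \<open>(1-x) / ((x+m)(x+m+1))\<close>.\<close>

lemma digit_mixing:
  fixes g :: "real \<Rightarrow> real"
  assumes [measurable]: "g \<in> borel_measurable borel"
    and g: "\<And>x. x \<in> {0..1} \<Longrightarrow> 0 \<le> g x" "\<And>x. x \<in> {0..1} \<Longrightarrow> g x \<le> C" and m: "m \<ge> 1"
  shows "(\<integral>x. digit_ind m x * g ((gauss_map ^^ Suc d) x) \<partial>gauss_measure)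
    \<le> (\<integral>x. digit_ind m x \<partial>gauss_measure) * (\<integral>x. g x \<partial>gauss_measure)
       + 3 / (real m * (real m + 1)) / 2 ^ d * (\<integral>x. g x \<partial>gauss_measure)"
proof -
  \<comment> \<open>\<open>cf_prob m\<close> itself need not be monotone: for m = 2 it equals 1/6 at
    both endpoints and is larger at 1/2.\<close>
  define s where "s = (\<lambda>x. 1 / ((x + real m) * (x + real m + 1)))"
  define r where "r = (\<lambda>x. (1 - x) * s x)"
  have [measurable]: "s \<in> borel_measurable borel" "r \<in> borel_measurable borel"
    unfolding s_def r_def by measurable
  define S where "S = s 0"
  have S: "S = 1 / (real m * (real m + 1))" by (simp add: S_def s_def)
  have s_mono: "s y \<le> s x" if "0 \<le> x" "x \<le> y" for x y
    unfolding s_def using that m by (intro divide_left_mono mult_mono mult_pos_pos) auto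
  have s_nonneg: "0 \<le> s x" if "x \<in> {0..1}" for x
    using that by (simp add: s_def)
  have s_le: "s x \<le> S" if "x \<in> {0..1}" for x
    unfolding S_def by (rule s_mono) (use that in auto)
  have r_nonneg: "0 \<le> r x" if "x \<in> {0..1}" for x
    unfolding r_def by (intro mult_nonneg_nonneg s_nonneg that) (use that in auto)
  have r_le: "r x \<le> S" if "x \<in> {0..1}" for x
  proof -
    have "(1 - x) * s x \<le> 1 * S" using s_nonneg[OF that] s_le[OF that] that by (intro mult_mono) auto
    then show ?thesis by (simp add: r_def)
  qed
  have s_anti: "mono_on {0..1} (\<lambda>x. - s x)"
    using s_mono by (intro mono_onI) auto
  have r_anti: "mono_on {0..1} (\<lambda>x. - r x)"
  proof (rule mono_onI)
    fix x y :: real assume "x \<in> {0..1}" "y \<in> {0..1}" "x \<le> y"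
    then have "(1 - y) * s y \<le> (1 - x) * s x"
      using s_mono[of x y] s_nonneg[of y] by (intro mult_mono) auto
    then show "- r x \<le> - r y" by (simp add: r_def)
  qed
  define h where "h = (\<lambda>x. g ((gauss_map ^^ d) x))"
  have [measurable]: "h \<in> borel_measurable borel" unfolding h_def by measurable
  have h: "0 \<le> h x" "h x \<le> C" if "x \<in> {0..1}" for x
    using g gauss_map_pow_mem[OF that] by (auto simp: h_def)
  define J where "J = (\<integral>x. g x \<partial>gauss_measure)"
  have int: "integrable gauss_measure (\<lambda>x. f x * h x)"
    if "f \<in> borel_measurable borel" "\<And>x. x \<in> {0..1} \<Longrightarrow> 0 \<le> f x" "\<And>x. x \<in> {0..1} \<Longrightarrow> f x \<le> S" for f
  proof (rule integrable_gauss_bounded[where B = "S * C"])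
    fix x :: real assume x: "x \<in> {0..1}"
    have "0 \<le> S" using that(2,3)[OF x] by linarith
    then have "f x * h x \<le> S * C" using that(2,3)[OF x] h[OF x] by (intro mult_mono) auto
    moreover have "0 \<le> f x * h x" using that(2)[OF x] h[OF x] by simp
    ultimately show "\<bar>f x * h x\<bar> \<le> S * C" by simp
  qed (use that(1) in measurable)
  have int1: "integrable gauss_measure f"
    if "f \<in> borel_measurable borel" "\<And>x. x \<in> {0..1} \<Longrightarrow> 0 \<le> f x" "\<And>x. x \<in> {0..1} \<Longrightarrow> f x \<le> S" for f
    using that by (intro integrable_gauss_bounded[where B = S]) auto
  have decomp: "cf_prob m x = 2 * s x - r x" for x
  proof -
    have "2 * s x - r x = (1 + x) * s x" by (simp add: r_def algebra_simps)
    then show ?thesis by (simp add: cf_prob_def s_def)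
  qed
  have int_s: "integrable gauss_measure s" "integrable gauss_measure r"
    by (rule int1, measurable, fact s_nonneg, fact s_le) (rule int1, measurable, fact r_nonneg, fact r_le)
  have int_sh: "integrable gauss_measure (\<lambda>x. s x * h x)" "integrable gauss_measure (\<lambda>x. r x * h x)"
    by (rule int, measurable, fact s_nonneg, fact s_le) (rule int, measurable, fact r_nonneg, fact r_le)
  have "(\<integral>x. digit_ind m x \<partial>gauss_measure) = (\<integral>x. cf_prob m x \<partial>gauss_measure)"
    using integral_digit_ind_gauss_map[of "\<lambda>_. 1" m] m by simp
  also have "\<dots> = (\<integral>x. 2 * s x - r x \<partial>gauss_measure)"
    by (simp only: decomp)
  also have "\<dots> = 2 * (\<integral>x. s x \<partial>gauss_measure) - (\<integral>x. r x \<partial>gauss_measure)"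
    using int_s by simp
  finally have p: "(\<integral>x. digit_ind m x \<partial>gauss_measure) = \<dots>" .
  \<comment> \<open>Of the \<open>Suc d\<close> shifts, one turns the indicator into
    \<open>cf_prob m\<close>; the other d remain for the contraction.\<close>
  have "(\<integral>x. digit_ind m x * g ((gauss_map ^^ Suc d) x) \<partial>gauss_measure) = (\<integral>x. digit_ind m x * h (gauss_map x) \<partial>gauss_measure)"
    by (simp only: h_def funpow_Suc_right o_apply)
  also have "\<dots> = (\<integral>x. cf_prob m x * h x \<partial>gauss_measure)"
    by (rule integral_digit_ind_gauss_map, measurable, fact h(1), fact m)
  also have "\<dots> = (\<integral>x. 2 * (s x * h x) - r x * h x \<partial>gauss_measure)"
    by (simp only: decomp left_diff_distrib mult.assoc)
  also have "\<dots> = 2 * (\<integral>x. s x * h x \<partial>gauss_measure) - (\<integral>x. r x * h x \<partial>gauss_measure)"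
    using int_sh by simp
  finally have eq: "(\<integral>x. digit_ind m x * g ((gauss_map ^^ Suc d) x) \<partial>gauss_measure) = \<dots>" .
  have "\<bar>(\<integral>x. s x * h x \<partial>gauss_measure) - (\<integral>x. s x \<partial>gauss_measure) * J\<bar> \<le> \<bar>s 1 - s 0\<bar> / 2 ^ d * J"
    unfolding h_def J_def
    by (rule gauss_mixing_monotone[where B = S and C = C], measurable, rule disjI2, fact s_anti,
        fact s_nonneg, fact s_le, fact g, fact g)
  moreover have "\<bar>(\<integral>x. r x * h x \<partial>gauss_measure) - (\<integral>x. r x \<partial>gauss_measure) * J\<bar> \<le> \<bar>r 1 - r 0\<bar> / 2 ^ d * J"
    unfolding h_def J_def
    by (rule gauss_mixing_monotone[where B = S and C = C], measurable, rule disjI2, fact r_anti,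
        fact r_nonneg, fact r_le, fact g, fact g)
  moreover have "J \<ge> 0"
    unfolding J_def using g by (intro integral_nonneg_AE eventually_mono[OF AE_gauss_measure_mem]) auto
  then have "\<bar>s 1 - s 0\<bar> / 2 ^ d * J \<le> S / 2 ^ d * J" "\<bar>r 1 - r 0\<bar> / 2 ^ d * J \<le> S / 2 ^ d * J"
  proof -
    have "\<bar>s 1 - s 0\<bar> \<le> S" "\<bar>r 1 - r 0\<bar> \<le> S"
      using s_nonneg[of 1] s_le[of 1] s_nonneg[of 0] by (auto simp: S_def r_def)
    then show "\<bar>s 1 - s 0\<bar> / 2 ^ d * J \<le> S / 2 ^ d * J" "\<bar>r 1 - r 0\<bar> / 2 ^ d * J \<le> S / 2 ^ d * J"
      using \<open>J \<ge> 0\<close> by (intro mult_right_mono divide_right_mono; simp)+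
  qed
  \<comment> \<open>The coefficients 2 and 1 of \<open>s\<close> and \<open>r\<close>, each with
    oscillation at most \<open>S\<close>, give the constant 3.\<close>
  ultimately have "2 * (\<integral>x. s x * h x \<partial>gauss_measure) - (\<integral>x. r x * h x \<partial>gauss_measure) \<le>
     (2 * (\<integral>x. s x \<partial>gauss_measure) - (\<integral>x. r x \<partial>gauss_measure)) * J + 3 * (S / 2 ^ d * J)"
    unfolding left_diff_distrib mult.assoc by linarith
  then show ?thesis unfolding eq p S J_def by simp
qed

lemma sum_geometric_dist_le:
  "(\<Sum>l\<in>{1..n}. (1 / 2 :: real) ^ (if l \<le> k then k - l else l - k)) \<le> 4"
proof -
  have geo: "(\<Sum>i<N. (1 / 2 :: real) ^ i) \<le> 2" for N
    by (subst geometric_sum) auto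
  let ?f = "\<lambda>l. (1 / 2 :: real) ^ (if l \<le> k then k - l else l - k)"
  have "(\<Sum>l\<in>{1..n}. ?f l) \<le> (\<Sum>l\<in>{..k} \<union> {k<..k + n}. ?f l)"
    by (intro sum_mono2) auto
  also have "\<dots> = (\<Sum>l\<in>{..k}. ?f l) + (\<Sum>l\<in>{k<..k + n}. ?f l)"
    by (intro sum.union_disjoint) auto
  also have "(\<Sum>l\<in>{..k}. ?f l) = (\<Sum>i<Suc k. (1 / 2) ^ i)"
    by (rule sum.reindex_bij_witness[of _ "\<lambda>i. k - i" "\<lambda>l. k - l"]) auto
  also have "(\<Sum>l\<in>{k<..k + n}. ?f l) \<le> (\<Sum>i<Suc n. (1 / 2) ^ i)"
  proof -
    have "(\<Sum>l\<in>{k<..k + n}. ?f l) = (\<Sum>i\<in>{1..n}. (1 / 2) ^ i)"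
      by (rule sum.reindex_bij_witness[of _ "\<lambda>i. k + i" "\<lambda>l. l - k"]) auto
    also have "\<dots> \<le> (\<Sum>i<Suc n. (1 / 2) ^ i)"
      by (intro sum_mono2) auto
    finally show ?thesis .
  qed
  finally show ?thesis using geo[of "Suc k"] geo[of "Suc n"] by linarith
qed

section \<open>Functions of a digit and the variance of their sums\<close>

lemma sum_digit_ind:
  fixes v :: "nat \<Rightarrow> real"
  assumes "v 0 = 0" "\<And>m. m > N \<Longrightarrow> v m = 0"
  shows "v (cf_digit 1 x) = (\<Sum>m=1..N. v m * digit_ind m x)"
proof -
  have "(\<Sum>m=1..N. v m * digit_ind m x) = (\<Sum>m\<in>{1..N}. if m = cf_digit 1 x then v m else 0)"
    by (intro sum.cong) (auto simp: digit_ind_def)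
  also have "\<dots> = v (cf_digit 1 x)"
    using assms by (cases "cf_digit 1 x = 0") (auto simp: sum.delta not_le)
  finally show ?thesis by simp
qed

lemma integrable_digit_ind_mult:
  assumes "g \<in> borel_measurable borel" "\<And>x. x \<in> {0..1} \<Longrightarrow> 0 \<le> g x" "\<And>x. x \<in> {0..1} \<Longrightarrow> g x \<le> (C :: real)"
  shows "integrable gauss_measure (\<lambda>x. digit_ind m x * g x)"
  using assms by (intro integrable_gauss_bounded[where B = C]) (auto simp: digit_ind_def intro: order_trans)

lemma integrable_digit_ind [simp]: "integrable gauss_measure (digit_ind m)"
  by (intro integrable_gauss_bounded[where B = 1]) (auto simp: digit_ind_def)

text \<open>A nonnegative function of the digit with finite support. The condition
  \<open>w 0 = 0\<close> takes care of the default digit 0 of a terminated expansion.\<close>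

locale digit_weight =
  fixes w :: "nat \<Rightarrow> real" and N :: nat
  assumes w_nonneg: "w m \<ge> 0" and w_zero: "w 0 = 0" and w_support: "m > N \<Longrightarrow> w m = 0"
begin

definition W :: "real \<Rightarrow> real" where "W x = w (cf_digit 1 x)"
text \<open>An explicit stand-in for \<open>mean\<close>, which is at most twice this. The error
  terms of \<open>digit_mixing\<close>, weighted by \<open>w\<close> and summed over m, are also
  multiples of it.\<close>

definition mass :: real where "mass = (\<Sum>m=1..N. w m / (real m * (real m + 1)))"
definition mean :: real where "mean = (\<integral>x. W x \<partial>gauss_measure)"
definition bound :: real where "bound = (\<Sum>m=1..N. w m)"

lemma measurable_W [measurable]: "W \<in> borel_measurable borel"
  unfolding W_def by measurable

lemma W_nonneg: "W x \<ge> 0"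
  by (simp add: W_def w_nonneg)

lemma w_le_bound: "w m \<le> bound"
proof (cases "m \<in> {1..N}")
  case True
  then show ?thesis unfolding bound_def by (intro member_le_sum) (auto simp: w_nonneg)
next
  case False
  then have "w m = 0" using w_zero w_support by (cases "m = 0") auto
  then show ?thesis by (simp add: bound_def sum_nonneg w_nonneg)
qed

lemma W_le_bound: "W x \<le> bound"
  by (simp add: W_def w_le_bound)

lemma W_eq: "W x = (\<Sum>m=1..N. w m * digit_ind m x)"
  unfolding W_def by (rule sum_digit_ind) (use w_zero w_support in auto)

lemma mean_eq: "mean = (\<Sum>m=1..N. w m * (\<integral>x. digit_ind m x \<partial>gauss_measure))"
  unfolding mean_def W_eq by (subst Bochner_Integration.integral_sum) auto

lemma mass_nonneg: "mass \<ge> 0"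
  unfolding mass_def by (intro sum_nonneg divide_nonneg_nonneg w_nonneg) auto

lemma mean_le_mass: "mean \<le> 2 * mass"
  unfolding mean_eq mass_def sum_distrib_left
proof (intro sum_mono)
  fix m assume "m \<in> {1..N}"
  then have "w m * (\<integral>x. digit_ind m x \<partial>gauss_measure) \<le> w m * (2 / (real m * (real m + 1)))"
    by (intro mult_left_mono digit_prob_bounds w_nonneg) auto
  then show "w m * (\<integral>x. digit_ind m x \<partial>gauss_measure) \<le> 2 * (w m / (real m * (real m + 1)))"
    by (simp add: mult_ac)
qed

lemma second_moment_le:
  "(\<integral>x. W x * W x \<partial>gauss_measure) \<le> 2 * (\<Sum>m=1..N. w m ^ 2 / (real m * (real m + 1)))"
proof -
  have "W x * W x = (\<Sum>m=1..N. w m ^ 2 * digit_ind m x)" for x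
    unfolding W_def power2_eq_square[symmetric]
    by (rule sum_digit_ind[of "\<lambda>m. w m ^ 2"]) (use w_zero w_support in auto)
  then have "(\<integral>x. W x * W x \<partial>gauss_measure) = (\<Sum>m=1..N. w m ^ 2 * (\<integral>x. digit_ind m x \<partial>gauss_measure))"
    by (simp add: Bochner_Integration.integral_sum)
  also have "\<dots> \<le> (\<Sum>m=1..N. w m ^ 2 * (2 / (real m * (real m + 1))))"
    by (intro sum_mono mult_left_mono digit_prob_bounds) auto
  also have "\<dots> = 2 * (\<Sum>m=1..N. w m ^ 2 / (real m * (real m + 1)))"
    by (simp add: sum_distrib_left mult_ac)
  finally show ?thesis .
qed

text \<open>\<open>digit_mixing\<close> is applied to every digit value m. Its error is relative to
  the mean of \<open>W\<close>, so only \<open>mass * mean\<close> enters and not the much larger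
  \<open>bound\<close>; \<open>mean_le_mass\<close> turns the factor 3 into 6.\<close>

lemma correlation_le:
  "(\<integral>x. W x * W ((gauss_map ^^ Suc d) x) \<partial>gauss_measure) \<le> mean ^ 2 + 6 * mass ^ 2 / 2 ^ d"
proof -
  have "(\<integral>x. W x * W ((gauss_map ^^ Suc d) x) \<partial>gauss_measure) =
      (\<integral>x. (\<Sum>m=1..N. w m * (digit_ind m x * W ((gauss_map ^^ Suc d) x))) \<partial>gauss_measure)"
    unfolding W_eq[of x for x] by (simp add: sum_distrib_right mult.assoc)
  also have "\<dots> = (\<Sum>m=1..N. w m * (\<integral>x. digit_ind m x * W ((gauss_map ^^ Suc d) x) \<partial>gauss_measure))"
    by (subst Bochner_Integration.integral_sum)
       (auto simp del: funpow.simps intro!: integrable_digit_ind_mult[where C = bound] W_nonneg W_le_bound)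
  also have "\<dots> \<le> (\<Sum>m=1..N. w m * ((\<integral>x. digit_ind m x \<partial>gauss_measure) * mean + 3 / (real m * (real m + 1)) / 2 ^ d * mean))"
    unfolding mean_def
    by (intro sum_mono mult_left_mono digit_mixing[where C = bound] w_nonneg W_nonneg W_le_bound) auto
  also have "\<dots> = mean * mean + 3 * mass / 2 ^ d * mean"
    unfolding mean_eq[THEN arg_cong[of _ _ "\<lambda>z. z * mean"]] mass_def
    by (simp add: sum.distrib distrib_left sum_distrib_right sum_distrib_left sum_divide_distrib mult_ac)
  also have "\<dots> \<le> mean ^ 2 + 3 * mass / 2 ^ d * (2 * mass)"
    using mean_le_mass mass_nonneg by (intro add_mono mult_left_mono) (auto simp: power2_eq_square)
  finally show ?thesis by (simp add: power2_eq_square mult_ac)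
qed

lemma w_cf_digit: "k \<ge> 1 \<Longrightarrow> w (cf_digit k x) = W ((gauss_map ^^ (k - 1)) x)"
  unfolding W_def using cf_digit_conv[of k x] by simp

lemma integral_pair:
  assumes "1 \<le> k" "k \<le> l"
  shows "(\<integral>x. w (cf_digit k x) * w (cf_digit l x) \<partial>gauss_measure) = (\<integral>x. W x * W ((gauss_map ^^ (l - k)) x) \<partial>gauss_measure)"
proof -
  have "l - 1 = (l - k) + (k - 1)" using assms by simp
  then have "(gauss_map ^^ (l - 1)) x = (gauss_map ^^ (l - k)) ((gauss_map ^^ (k - 1)) x)" for x
    by (simp only: funpow_add o_apply)
  then have "(\<integral>x. w (cf_digit k x) * w (cf_digit l x) \<partial>gauss_measure) =
      (\<integral>x. W ((gauss_map ^^ (k - 1)) x) * W ((gauss_map ^^ (l - k)) ((gauss_map ^^ (k - 1)) x)) \<partial>gauss_measure)"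
    using assms by (simp only: w_cf_digit)
  also have "\<dots> = (\<integral>x. W x * W ((gauss_map ^^ (l - k)) x) \<partial>gauss_measure)"
    by (rule integral_gauss_map_pow[of "\<lambda>x. W x * W ((gauss_map ^^ (l - k)) x)"]) (auto simp: W_nonneg)
  finally show ?thesis .
qed

lemma pair_moment_less:
  assumes "1 \<le> k" "k < l"
  shows "(\<integral>x. w (cf_digit k x) * w (cf_digit l x) \<partial>gauss_measure) \<le> mean ^ 2 + 12 * mass ^ 2 * (1 / 2) ^ (l - k)"
proof -
  obtain d where d: "l - k = Suc d" using assms by (cases "l - k") auto
  have "(\<integral>x. w (cf_digit k x) * w (cf_digit l x) \<partial>gauss_measure) = (\<integral>x. W x * W ((gauss_map ^^ Suc d) x) \<partial>gauss_measure)"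
    using integral_pair[of k l] assms d by simp
  also have "\<dots> \<le> mean ^ 2 + 6 * mass ^ 2 / 2 ^ d" by (rule correlation_le)
  \<comment> \<open>The distance is \<open>Suc d\<close>, so writing the decay in terms of
    \<open>l - k\<close> doubles the constant.\<close>
  also have "6 * mass ^ 2 / 2 ^ d = 12 * mass ^ 2 * (1 / 2) ^ (l - k)"
    unfolding d by (simp add: power_divide)
  finally show ?thesis .
qed

text \<open>The diagonal needs only the second moment; the other terms are nonnegative there and
  stay so that one formula serves the double sum.\<close>

lemma pair_moment:
  assumes "1 \<le> k" "1 \<le> l"
  shows "(\<integral>x. w (cf_digit k x) * w (cf_digit l x) \<partial>gauss_measure) \<le>
    mean ^ 2 + (if l = k then 2 * (\<Sum>m=1..N. w m ^ 2 / (real m * (real m + 1))) else 0)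
     + 12 * mass ^ 2 * (1 / 2) ^ (if l \<le> k then k - l else l - k)"
proof -
  consider "k < l" | "l < k" | "k = l" by linarith
  then show ?thesis
  proof cases
    assume "k < l"
    then show ?thesis using pair_moment_less[OF assms(1)] by simp
  next
    assume "l < k"
    then show ?thesis using pair_moment_less[OF assms(2)] by (simp add: mult.commute)
  next
    assume "k = l"
    then have "(\<integral>x. w (cf_digit k x) * w (cf_digit l x) \<partial>gauss_measure) = (\<integral>x. W x * W x \<partial>gauss_measure)"
      using integral_pair[of k l] assms by simp
    also have "\<dots> \<le> 2 * (\<Sum>m=1..N. w m ^ 2 / (real m * (real m + 1)))" by (rule second_moment_le)
    finally show ?thesis using \<open>k = l\<close> by (simp add: add_increasing add_increasing2)
  qed
qed

lemma integral_w_cf_digit: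
  assumes "1 \<le> k"
  shows "(\<integral>x. w (cf_digit k x) \<partial>gauss_measure) = mean"
  unfolding w_cf_digit[OF assms] mean_def by (rule integral_gauss_map_pow) (auto simp: W_nonneg)

lemma measurable_w_cf_digit [measurable]: "(\<lambda>x. w (cf_digit k x)) \<in> borel_measurable borel"
  by measurable

lemma integrable_w_cf_digit:
  "integrable gauss_measure (\<lambda>x. w (cf_digit k x))"
  "integrable gauss_measure (\<lambda>x. w (cf_digit k x) * w (cf_digit l x))"
proof -
  show "integrable gauss_measure (\<lambda>x. w (cf_digit k x))"
    by (rule integrable_gauss_bounded[where B = bound], measurable) (simp add: w_nonneg w_le_bound)
  have "0 \<le> bound" using w_nonneg[of 0] w_le_bound[of 0] by linarith
  then show "integrable gauss_measure (\<lambda>x. w (cf_digit k x) * w (cf_digit l x))"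
    by (intro integrable_gauss_bounded[where B = "bound * bound"])
       (auto simp: w_nonneg w_le_bound abs_mult intro!: mult_mono)
qed

text \<open>Upper bounds for the pair moments suffice: the terms \<open>mean ^ 2\<close> add up to
  \<open>(real n * mean) ^ 2\<close> and cancel. Each row keeps one diagonal term and a geometric
  sum of correlations, at most 4 times 12 \<open>mass ^ 2\<close>.\<close>

lemma variance_le:
  "(\<integral>x. ((\<Sum>k=1..n. w (cf_digit k x)) - real n * mean) ^ 2 \<partial>gauss_measure)
    \<le> real n * (2 * (\<Sum>m=1..N. w m ^ 2 / (real m * (real m + 1))) + 48 * mass ^ 2)"
proof -
  define Q where "Q = 2 * (\<Sum>m=1..N. w m ^ 2 / (real m * (real m + 1)))"
  define c where "c = 12 * mass ^ 2"
  define h where "h k l = (1 / 2 :: real) ^ (if l \<le> k then k - l else l - k)" for k l :: nat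
  define A B where "A x = (\<Sum>k=1..n. \<Sum>l=1..n. w (cf_digit k x) * w (cf_digit l x))"
    and "B x = (\<Sum>k=1..n. w (cf_digit k x))" for x
  have int: "integrable gauss_measure A" "integrable gauss_measure B"
    unfolding A_def B_def by (intro Bochner_Integration.integrable_sum integrable_w_cf_digit)+
  have "B x ^ 2 = A x" for x
    by (simp only: A_def B_def power2_eq_square sum_product)
  then have sq: "(B x - real n * mean) ^ 2 = A x - 2 * (real n * mean) * B x + (real n * mean) ^ 2" for x
    by (simp add: power2_diff)
  have "(\<integral>x. (B x - real n * mean) ^ 2 \<partial>gauss_measure) =
      (\<integral>x. A x \<partial>gauss_measure) - 2 * (real n * mean) * (\<integral>x. B x \<partial>gauss_measure) + (real n * mean) ^ 2"
    unfolding sq using int gauss.prob_space by simp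
  also have "(\<integral>x. B x \<partial>gauss_measure) = real n * mean"
    unfolding B_def by (subst Bochner_Integration.integral_sum) (simp_all add: integrable_w_cf_digit integral_w_cf_digit)
  also have "(\<integral>x. A x \<partial>gauss_measure) = (\<Sum>k=1..n. \<Sum>l=1..n. (\<integral>x. w (cf_digit k x) * w (cf_digit l x) \<partial>gauss_measure))"
    unfolding A_def
    by (subst Bochner_Integration.integral_sum, intro Bochner_Integration.integrable_sum integrable_w_cf_digit)
       (subst Bochner_Integration.integral_sum, rule integrable_w_cf_digit, rule refl)
  finally have "(\<integral>x. ((\<Sum>k=1..n. w (cf_digit k x)) - real n * mean) ^ 2 \<partial>gauss_measure) =
      (\<Sum>k=1..n. \<Sum>l=1..n. (\<integral>x. w (cf_digit k x) * w (cf_digit l x) \<partial>gauss_measure)) - (real n * mean) ^ 2"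
    by (simp add: B_def power2_eq_square)
  also have "\<dots> \<le> (\<Sum>k=1..n. \<Sum>l=1..n. mean ^ 2 + (if l = k then Q else 0) + c * h k l) - (real n * mean) ^ 2"
    unfolding Q_def c_def h_def by (intro diff_right_mono sum_mono pair_moment) simp_all
  also have "\<dots> = (\<Sum>k=1..n. real n * mean ^ 2 + (Q + c * (\<Sum>l=1..n. h k l))) - (real n * mean) ^ 2"
  proof -
    have "(\<Sum>l=1..n. mean ^ 2 + (if l = k then Q else 0) + c * h k l) = real n * mean ^ 2 + (Q + c * (\<Sum>l=1..n. h k l))"
      if "k \<in> {1..n}" for k
    proof -
      have "(\<Sum>l=1..n. if l = k then Q else 0) = Q" using that by simp
      moreover have "(\<Sum>l=1..n. mean ^ 2) = real n * mean ^ 2" by simp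
      ultimately show ?thesis by (simp only: sum.distrib sum_distrib_left add.assoc)
    qed
    then show ?thesis by (intro arg_cong2[where f = minus] sum.cong refl)
  qed
  also have "\<dots> \<le> (\<Sum>k=1..n. real n * mean ^ 2 + (Q + c * 4)) - (real n * mean) ^ 2"
    unfolding h_def c_def
    by (intro diff_right_mono sum_mono add_left_mono mult_left_mono sum_geometric_dist_le) simp
  also have "\<dots> = real n * (Q + 48 * mass ^ 2)"
    by (simp add: c_def power2_eq_square algebra_simps)
  finally show ?thesis unfolding Q_def .
qed

end

section \<open>Prime digits truncated at a level: mean and second moment\<close>

definition prime_trunc :: "nat \<Rightarrow> nat \<Rightarrow> real" where
  "prime_trunc f m = (if prime m \<and> m \<le> f then real m else 0)"

interpretation prime_trunc: digit_weight "prime_trunc f" f for f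
  by unfold_locales (auto simp: prime_trunc_def)

lemma sum_prime_trunc:
  "(\<Sum>m=1..f::nat. if prime m then h m else 0) = (\<Sum>p\<in>{p\<in>{1..f}. prime p}. h p :: real)"
  by (rule sum.inter_filter[symmetric]) (rule finite_atLeastAtMost)

lemma prime_trunc_mass_le:
  "prime_trunc.mass f \<le> (\<Sum>p\<in>{p\<in>{1..f}. prime p}. 1 / real p)"
  unfolding prime_trunc.mass_def sum_prime_trunc[symmetric]
  by (intro sum_mono) (auto simp: prime_trunc_def divide_simps)

text \<open>A prime p contributes p^2 / (p (p + 1)) <= 1, so the sum is at most the number of primes
  up to f.\<close>

lemma prime_trunc_second_moment_le:
  assumes "f \<ge> 2"
  shows "(\<Sum>m=1..f. prime_trunc f m ^ 2 / (real m * (real m + 1))) \<le> 10 * real f / ln (real f)"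
proof -
  have "(\<Sum>m=1..f. prime_trunc f m ^ 2 / (real m * (real m + 1))) \<le> (\<Sum>m=1..f. if prime m then 1 else 0)"
    by (intro sum_mono) (auto simp: prime_trunc_def divide_simps power2_eq_square)
  also have "\<dots> = real (card {p\<in>{1..f}. prime p})"
    unfolding sum_prime_trunc by simp
  also have "\<dots> \<le> 10 * real f / ln (real f)" by (rule card_primes_le[OF assms])
  finally show ?thesis .
qed

text \<open>Up to the factor 1 / ln 2, p times the probability of digit p lies between 1/p - 3/p^2
  and 1/p. The corrections 3/p^2 have a convergent sum, and \<open>mertens_second\<close> evaluates
  the rest.\<close>

lemma prime_trunc_mean_bounds:
  "\<exists>C. \<forall>f\<ge>2. \<bar>prime_trunc.mean f - ln (ln (real f)) / ln 2\<bar> \<le> C"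
proof -
  obtain C where C: "\<And>n. n \<ge> 2 \<Longrightarrow> \<bar>(\<Sum>p\<in>{p\<in>{1..n}. prime p}. 1 / real p) - ln (ln (real n))\<bar> \<le> C"
    using mertens_second by blast
  have sq: "summable (\<lambda>m. 1 / real m ^ 2)"
    using inverse_power_summable[of 2, where ?'a = real] by (simp add: inverse_eq_divide)
  define D where "D = (\<Sum>m. 1 / real m ^ 2)"
  have "\<bar>prime_trunc.mean f - ln (ln (real f)) / ln 2\<bar> \<le> (C + 3 * D) / ln 2" if f: "f \<ge> 2" for f
  proof -
    let ?S = "\<Sum>p\<in>{p\<in>{1..f}. prime p}. 1 / real p"
    have "prime_trunc.mean f \<le> (\<Sum>m=1..f. if prime m then 1 / ln 2 * (1 / real m) else 0)"
      unfolding prime_trunc.mean_eq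
    proof (intro sum_mono)
      fix m assume m: "m \<in> {1..f}"
      have "real m * (\<integral>x. digit_ind m x \<partial>gauss_measure) \<le> real m * (1 / ln 2 / (real m * (real m + 1)))"
        using m by (intro mult_left_mono digit_prob_bounds) auto
      also have "\<dots> = 1 / ln 2 * (1 / (real m + 1))" using m by simp
      also have "\<dots> \<le> 1 / ln 2 * (1 / real m)"
        using m by (intro mult_left_mono) (auto intro!: frac_le)
      finally show "prime_trunc f m * (\<integral>x. digit_ind m x \<partial>gauss_measure) \<le> (if prime m then 1 / ln 2 * (1 / real m) else 0)"
        using m by (auto simp: prime_trunc_def)
    qed
    also have "\<dots> = 1 / ln 2 * ?S"
      unfolding sum_prime_trunc by (simp only: sum_distrib_left)
    finally have 1: "prime_trunc.mean f \<le> ?S / ln 2" by simp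
    have "(\<Sum>m=1..f. if prime m then 1 / ln 2 * (1 / real m - 3 / real m ^ 2) else 0) \<le> prime_trunc.mean f"
      unfolding prime_trunc.mean_eq
    proof (intro sum_mono)
      fix m assume m: "m \<in> {1..f}"
      define t where "t = real m"
      have t: "t > 0" using m by (simp add: t_def)
      \<comment> \<open>The constant 3 cancels the quadratic terms; the right side exceeds the left
        by 7t + 6.\<close>
      have "(t - 3) * ((t + 1) * (t + 2)) \<le> t ^ 3"
        using t by (simp add: algebra_simps power3_eq_cube)
      then have "(t - 3) / t ^ 2 \<le> t / ((t + 1) * (t + 2))"
      proof -
        have "(t - 3) / t ^ 2 * ((t + 1) * (t + 2)) = (t - 3) * ((t + 1) * (t + 2)) / t ^ 2" by simp
        also have "\<dots> \<le> t ^ 3 / t ^ 2"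
          using \<open>(t - 3) * ((t + 1) * (t + 2)) \<le> t ^ 3\<close> by (intro divide_right_mono) auto
        also have "\<dots> = t" using t by (simp add: power2_eq_square power3_eq_cube)
        finally show ?thesis using t by (subst pos_le_divide_eq) auto
      qed
      then have "1 / t - 3 / t ^ 2 \<le> t / ((t + 1) * (t + 2))"
        using t by (simp add: diff_divide_distrib power2_eq_square)
      then have "1 / ln 2 * (1 / t - 3 / t ^ 2) \<le> 1 / ln 2 * (t / ((t + 1) * (t + 2)))"
        by (intro mult_left_mono) auto
      also have "\<dots> = t * (1 / ln 2 / ((t + 1) * (t + 2)))" by simp
      also have "\<dots> \<le> t * (\<integral>x. digit_ind m x \<partial>gauss_measure)"
        unfolding t_def using m by (intro mult_left_mono digit_prob_bounds) auto
      finally show "(if prime m then 1 / ln 2 * (1 / real m - 3 / real m ^ 2) else 0) \<le>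
          prime_trunc f m * (\<integral>x. digit_ind m x \<partial>gauss_measure)"
        using m by (auto simp: prime_trunc_def t_def)
    qed
    also have "(\<Sum>m=1..f. if prime m then 1 / ln 2 * (1 / real m - 3 / real m ^ 2) else 0) =
       1 / ln 2 * (?S - 3 * (\<Sum>p\<in>{p\<in>{1..f}. prime p}. 1 / real p ^ 2))"
      unfolding sum_prime_trunc sum_distrib_left[symmetric] sum_subtractf
      by (simp add: sum_distrib_left)
    finally have "(?S - 3 * (\<Sum>p\<in>{p\<in>{1..f}. prime p}. 1 / real p ^ 2)) / ln 2 \<le> prime_trunc.mean f" by simp
    moreover have "(\<Sum>p\<in>{p\<in>{1..f}. prime p}. 1 / real p ^ 2) \<le> D"
      unfolding D_def by (intro sum_le_suminf sq) auto
    then have "(?S - 3 * D) / ln 2 \<le> (?S - 3 * (\<Sum>p\<in>{p\<in>{1..f}. prime p}. 1 / real p ^ 2)) / ln 2"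
      by (intro divide_right_mono) auto
    ultimately have 2: "(?S - 3 * D) / ln 2 \<le> prime_trunc.mean f" by linarith
    have "D \<ge> 0" unfolding D_def by (intro suminf_nonneg sq) auto
    have "?S / ln 2 \<le> (ln (ln (real f)) + (C + 3 * D)) / ln 2"
      "(ln (ln (real f)) - (C + 3 * D)) / ln 2 \<le> (?S - 3 * D) / ln 2"
      using C[OF f] \<open>D \<ge> 0\<close> by (auto intro!: divide_right_mono)
    with 1 2 show ?thesis unfolding add_divide_distrib[of "ln (ln (real f))"] diff_divide_distrib[of "ln (ln (real f))"]
      by linarith
  qed
  then show ?thesis by blast
qed

section \<open>Two large prime digits\<close>

definition exceeds :: "nat \<Rightarrow> real \<Rightarrow> real" where
  "exceeds u x = (if prime (cf_digit 1 x) \<and> cf_digit 1 x > u then 1 else 0)"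

lemma measurable_exceeds [measurable]: "exceeds u \<in> borel_measurable borel"
  unfolding exceeds_def by measurable

lemma exceeds_bounds: "0 \<le> exceeds u x" "exceeds u x \<le> 1"
  by (auto simp: exceeds_def)

text \<open>The bound is uniform in x: whatever the later digits are, the first is a prime above u
  with conditional probability at most this. The constant is 2 from \<open>cf_prob_le\<close> times
  12 from the tail of the sum of 1/p^2.\<close>

lemma transfer_exceeds_le:
  assumes "u \<ge> 2" "x \<in> {0<..<1}"
  shows "transfer (exceeds u) x \<le> 24 / (real u * ln (real u))"
  unfolding transfer_def
proof (rule suminf_le_const)
  show "summable (\<lambda>i. cf_prob (Suc i) x * exceeds u (1 / (x + real (Suc i))))"
    using assms exceeds_bounds by (intro summable_transfer[where B = 1]) auto
next
  fix n
  have "(\<Sum>i<n. cf_prob (Suc i) x * exceeds u (1 / (x + real (Suc i)))) =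
      (\<Sum>i<n. cf_prob (Suc i) x * (if prime (Suc i) \<and> Suc i > u then 1 else 0))"
    using assms by (simp only: exceeds_def cf_digit_inverse_branch)
  also have "\<dots> = (\<Sum>m\<in>{1..n}. cf_prob m x * (if prime m \<and> m > u then 1 else 0))"
    by (rule sum.reindex_bij_witness[of _ "\<lambda>m. m - 1" Suc]) auto
  also have "\<dots> = (\<Sum>p\<in>{p\<in>{u<..n}. prime p}. cf_prob p x)"
    using assms by (intro sum.mono_neutral_cong_right) auto
  also have "\<dots> \<le> (\<Sum>p\<in>{p\<in>{u<..n}. prime p}. 2 * (1 / real p ^ 2))"
  proof (intro sum_mono)
    fix p assume p: "p \<in> {p\<in>{u<..n}. prime p}"
    have "cf_prob p x \<le> 2 / (real p * (real p + 1))" using p assms by (intro cf_prob_le) auto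
    also have "\<dots> \<le> 2 / (real p * real p)" using p by (intro divide_left_mono mult_left_mono) auto
    finally show "cf_prob p x \<le> 2 * (1 / real p ^ 2)" by (simp add: power2_eq_square)
  qed
  also have "\<dots> = 2 * (\<Sum>p\<in>{p\<in>{u<..n}. prime p}. 1 / real p ^ 2)"
    by (simp only: sum_distrib_left)
  also have "\<dots> \<le> 2 * (12 / (real u * ln (real u)))"
    by (intro mult_left_mono sum_primes_inverse_square_tail_le assms) auto
  finally show "(\<Sum>i<n. cf_prob (Suc i) x * exceeds u (1 / (x + real (Suc i)))) \<le> 24 / (real u * ln (real u))"
    by simp
qed

lemma integral_exceeds_mult_le:
  assumes "u \<ge> 2" and [measurable]: "g \<in> borel_measurable borel"
    and g: "\<And>x. x \<in> {0..1} \<Longrightarrow> 0 \<le> g x" "\<And>x. x \<in> {0..1} \<Longrightarrow> g x \<le> (1::real)"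
  shows "(\<integral>x. exceeds u x * g (gauss_map x) \<partial>gauss_measure) \<le> 24 / (real u * ln (real u)) * (\<integral>x. g x \<partial>gauss_measure)"
proof -
  define K where "K = 24 / (real u * ln (real u))"
  have K: "K \<ge> 0" using assms by (simp add: K_def)
  have "(\<integral>x. exceeds u x * g (gauss_map x) \<partial>gauss_measure) = (\<integral>x. transfer (exceeds u) x * g x \<partial>gauss_measure)"
    by (rule integral_gauss_transfer[where B = 1]) (auto simp: exceeds_bounds g)
  also have "\<dots> \<le> (\<integral>x. K * g x \<partial>gauss_measure)"
  proof (rule integral_gauss_mono[where B = 1 and C = K])
    fix x :: real assume x: "x \<in> {0..1}"
    have "0 \<le> transfer (exceeds u) x" "transfer (exceeds u) x \<le> 1"
      using x exceeds_bounds[of u] transfer_bounds[of x 0 "exceeds u" 1] by auto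
    then show "\<bar>transfer (exceeds u) x * g x\<bar> \<le> 1"
      using g[OF x] by (auto simp: abs_mult intro!: mult_le_one)
    have "K * g x \<le> K * 1" using g[OF x] K by (intro mult_left_mono) auto
    then show "\<bar>K * g x\<bar> \<le> K" using g[OF x] K by (simp add: abs_mult)
  next
    fix x :: real assume x: "x \<in> {0<..<1}"
    then show "transfer (exceeds u) x * g x \<le> K * g x"
      unfolding K_def using g[of x] by (intro mult_right_mono transfer_exceeds_le assms) auto
  qed measurable
  finally show ?thesis by (simp add: K_def)
qed

text \<open>Invariance shifts the earlier index to 0; then the uniform bound of
  \<open>transfer_exceeds_le\<close> splits off one factor. This works at every distance,
  neighbouring digits included.\<close>

lemma integral_exceeds_pair_le:
  assumes "u \<ge> 2" "k \<noteq> l"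
  shows "(\<integral>x. exceeds u ((gauss_map ^^ k) x) * exceeds u ((gauss_map ^^ l) x) \<partial>gauss_measure) \<le> (24 / (real u * ln (real u))) ^ 2"
proof -
  let ?K = "24 / (real u * ln (real u))"
  have K: "?K \<ge> 0" using assms by simp
  have *: "(\<integral>x. exceeds u ((gauss_map ^^ k) x) * exceeds u ((gauss_map ^^ l) x) \<partial>gauss_measure) \<le> ?K ^ 2" if "k < l" for k l
  proof -
    define d where "d = l - k - 1"
    have l: "l = d + Suc k" using that by (simp add: d_def)
    have "(\<integral>x. exceeds u ((gauss_map ^^ k) x) * exceeds u ((gauss_map ^^ l) x) \<partial>gauss_measure) =
        (\<integral>x. exceeds u ((gauss_map ^^ k) x) * exceeds u ((gauss_map ^^ d) (gauss_map ((gauss_map ^^ k) x))) \<partial>gauss_measure)"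
      unfolding l by (simp only: funpow_add funpow.simps(2) o_apply)
    also have "\<dots> = (\<integral>x. exceeds u x * exceeds u ((gauss_map ^^ d) (gauss_map x)) \<partial>gauss_measure)"
      by (rule integral_gauss_map_pow[of "\<lambda>x. exceeds u x * exceeds u ((gauss_map ^^ d) (gauss_map x))"]) (auto simp: exceeds_bounds)
    also have "\<dots> \<le> ?K * (\<integral>x. exceeds u ((gauss_map ^^ d) x) \<partial>gauss_measure)"
      by (rule integral_exceeds_mult_le[OF assms(1)]) (auto simp: exceeds_bounds)
    also have "(\<integral>x. exceeds u ((gauss_map ^^ d) x) \<partial>gauss_measure) = (\<integral>x. exceeds u x \<partial>gauss_measure)"
      by (rule integral_gauss_map_pow) (auto simp: exceeds_bounds)
    also have "?K * (\<integral>x. exceeds u x \<partial>gauss_measure) \<le> ?K * ?K"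
      using integral_exceeds_mult_le[OF assms(1), of "\<lambda>_. 1"] K
      by (intro mult_left_mono) (simp_all add: gauss.prob_space[unfolded space_gauss_measure])
    finally show ?thesis by (simp only: power2_eq_square)
  qed
  show ?thesis
  proof (cases "k < l")
    case False
    then have "l < k" using assms(2) by simp
    from *[OF this] show ?thesis by (simp only: mult.commute)
  next
    case True
    then show ?thesis by (rule *)
  qed
qed

section \<open>The trimmed law along blocks\<close>

text \<open>The Borel-Cantelli argument in integral form: the sum of all \<open>Z j\<close> has
  finite integral, so it converges almost everywhere.\<close>

lemma AE_tendsto_zero_of_summable_integral:
  fixes Z :: "nat \<Rightarrow> 'a \<Rightarrow> real"
  assumes int: "\<And>j. integrable M (Z j)" and nonneg: "\<And>j x. Z j x \<ge> 0"
    and sum: "summable (\<lambda>j. \<integral>x. Z j x \<partial>M)"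
  shows "AE x in M. (\<lambda>j. Z j x) \<longlonglongrightarrow> 0"
proof -
  have [measurable]: "Z j \<in> borel_measurable M" for j using int by auto
  have "(\<integral>\<^sup>+x. (\<Sum>j. ennreal (Z j x)) \<partial>M) = (\<Sum>j. \<integral>\<^sup>+x. ennreal (Z j x) \<partial>M)"
    by (rule nn_integral_suminf) measurable
  also have "\<dots> = (\<Sum>j. ennreal (\<integral>x. Z j x \<partial>M))"
    using int nonneg by (intro suminf_cong nn_integral_eq_integral) auto
  also have "\<dots> = ennreal (\<Sum>j. \<integral>x. Z j x \<partial>M)"
    using nonneg by (intro suminf_ennreal2 sum integral_nonneg_AE) auto
  finally have "(\<integral>\<^sup>+x. (\<Sum>j. ennreal (Z j x)) \<partial>M) \<noteq> \<infinity>" by simp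
  then have "AE x in M. (\<Sum>j. ennreal (Z j x)) \<noteq> \<infinity>"
    by (intro nn_integral_noteq_infinite) measurable
  then show ?thesis
  proof eventually_elim
    fix x assume "(\<Sum>j. ennreal (Z j x)) \<noteq> \<infinity>"
    then have "summable (\<lambda>j. Z j x)"
      using nonneg by (intro summable_suminf_not_top) auto
    then show "(\<lambda>j. Z j x) \<longlonglongrightarrow> 0" by (rule summable_LIMSEQ_zero)
  qed
qed

text \<open>A given n belongs to the block of the last j with \<open>b j \<le> n\<close>. Such a
  last j exists because \<open>b\<close> tends to infinity, and it is at least J once
  \<open>n \<ge> b J\<close>.\<close>

lemma eventually_of_blocks:
  fixes b :: "nat \<Rightarrow> nat"
  assumes b: "filterlim b at_top sequentially"
    and P: "eventually (\<lambda>j. \<forall>n. b j \<le> n \<and> n < b (Suc j) \<longrightarrow> P n) sequentially"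
  shows "eventually P sequentially"
proof -
  obtain J where J: "\<And>j n. j \<ge> J \<Longrightarrow> b j \<le> n \<Longrightarrow> n < b (Suc j) \<Longrightarrow> P n"
    using P unfolding eventually_sequentially by blast
  have "P n" if n: "n \<ge> b J" for n
  proof -
    let ?A = "{j. b j \<le> n}"
    have "eventually (\<lambda>j. b j \<ge> Suc n) sequentially"
      using b by (simp add: filterlim_at_top)
    then obtain K where K: "\<And>j. j \<ge> K \<Longrightarrow> b j \<ge> Suc n"
      unfolding eventually_sequentially by blast
    have "?A \<subseteq> {..<K}"
    proof
      fix j assume "j \<in> ?A"
      then show "j \<in> {..<K}" using K[of j] by (cases "j \<ge> K") auto
    qed
    then have fin: "finite ?A" by (rule finite_subset) simp
    have "J \<in> ?A" using n by simp
    then have "Max ?A \<in> ?A" by (intro Max_in fin) blast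
    moreover have "J \<le> Max ?A" by (rule Max_ge[OF fin \<open>J \<in> ?A\<close>])
    moreover have "Suc (Max ?A) \<notin> ?A" using Max_ge[OF fin, of "Suc (Max ?A)"] by auto
    ultimately show ?thesis using J[of "Max ?A" n] by (simp add: not_le)
  qed
  then show ?thesis unfolding eventually_sequentially by blast
qed

lemma tendsto_of_blocks:
  fixes v lo hi :: "nat \<Rightarrow> real"
  assumes b: "filterlim b at_top sequentially" and "lo \<longlonglongrightarrow> L" "hi \<longlonglongrightarrow> L"
    and P: "eventually (\<lambda>j. \<forall>n. b j \<le> n \<and> n < b (Suc j) \<longrightarrow> lo j \<le> v n \<and> v n \<le> hi j) sequentially"
  shows "v \<longlonglongrightarrow> L"
proof (rule order_tendstoI)
  fix a assume "a < L"
  with assms(2) have "eventually (\<lambda>j. a < lo j) sequentially" by (rule order_tendstoD)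
  with P have "eventually (\<lambda>j. \<forall>n. b j \<le> n \<and> n < b (Suc j) \<longrightarrow> a < v n) sequentially"
    by eventually_elim force
  then show "eventually (\<lambda>n. a < v n) sequentially" by (rule eventually_of_blocks[OF b])
next
  fix a assume "L < a"
  with assms(3) have "eventually (\<lambda>j. hi j < a) sequentially" by (rule order_tendstoD)
  with P have "eventually (\<lambda>j. \<forall>n. b j \<le> n \<and> n < b (Suc j) \<longrightarrow> v n < a) sequentially"
    by eventually_elim force
  then show "eventually (\<lambda>n. v n < a) sequentially" by (rule eventually_of_blocks[OF b])
qed

text \<open>Let m be an index where the maximum is attained. An index other than m with value above
  f would force \<open>X m > f\<close> as well, against the hypothesis; so without m the sum agrees
  with the truncated one. Restoring the truncated term at m costs at most f.\<close>

lemma trimmed_sum_bounds: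
  fixes X :: "nat \<Rightarrow> nat"
  defines "Y \<equiv> \<lambda>f k. real (if X k \<le> f then X k else 0)"
  assumes excl: "\<And>k l. k \<in> {1..n'} \<Longrightarrow> l \<in> {1..n'} \<Longrightarrow> k \<noteq> l \<Longrightarrow> \<not> (X k > f \<and> X l > f)"
    and n: "1 \<le> n" "N \<le> n" "n \<le> n'"
  shows "(\<Sum>k=1..N. Y f k) - real f \<le> (\<Sum>k=1..n. real (X k)) - real (Max (X ` {1..n}))"
    and "(\<Sum>k=1..n. real (X k)) - real (Max (X ` {1..n})) \<le> (\<Sum>k=1..n'. Y f k)"
proof -
  have "Max (X ` {1..n}) \<in> X ` {1..n}" using n by (intro Max_in) auto
  then obtain m where m: "m \<in> {1..n}" "Max (X ` {1..n}) = X m" by auto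
  have max: "X k \<le> X m" if "k \<in> {1..n}" for k
    unfolding m(2)[symmetric] using that by (intro Max_ge) auto
  have Y: "X k \<le> f" if "k \<in> {1..n} - {m}" for k
    using excl[of k m] max[of k] that m(1) n by force
  have Y_bounds: "0 \<le> Y f k" "Y f k \<le> real f" for k by (auto simp: Y_def)
  have "(\<Sum>k=1..n. real (X k)) = real (X m) + (\<Sum>k\<in>{1..n} - {m}. real (X k))"
    using m(1) by (intro sum.remove) auto
  also have "(\<Sum>k\<in>{1..n} - {m}. real (X k)) = (\<Sum>k\<in>{1..n} - {m}. Y f k)"
    using Y by (intro sum.cong) (auto simp: Y_def)
  finally have eq: "(\<Sum>k=1..n. real (X k)) - real (Max (X ` {1..n})) = (\<Sum>k\<in>{1..n} - {m}. Y f k)"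
    unfolding m(2) by simp
  show "(\<Sum>k=1..n. real (X k)) - real (Max (X ` {1..n})) \<le> (\<Sum>k=1..n'. Y f k)"
    unfolding eq using n Y_bounds by (intro sum_mono2) auto
  have "(\<Sum>k=1..N. Y f k) \<le> (\<Sum>k=1..n. Y f k)"
    using n Y_bounds by (intro sum_mono2) auto
  also have "\<dots> = Y f m + (\<Sum>k\<in>{1..n} - {m}. Y f k)"
    using m(1) by (intro sum.remove) auto
  finally show "(\<Sum>k=1..N. Y f k) - real f \<le> (\<Sum>k=1..n. real (X k)) - real (Max (X ` {1..n}))"
    unfolding eq using Y_bounds(2)[of m] by linarith
qed

text \<open>The exponent 9/10 makes consecutive block ends asymptotically equal, while both the variance
  term (of order \<open>lvl / (blk * ln lvl)\<close>) and the double-exceedance term (of order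
  \<open>(blk / (lvl * ln lvl))^2\<close>) are \<open>O(j powr (-6/5))\<close>, hence summable.\<close>

definition blk :: "nat \<Rightarrow> nat" where
  "blk j = nat \<lceil>exp (real j powr (9/10))\<rceil>"

definition lvl :: "nat \<Rightarrow> nat" where
  "lvl j = nat \<lfloor>exp (real j powr (9/10)) / real j powr (3/10)\<rfloor>"

definition trunc_sum :: "nat \<Rightarrow> nat \<Rightarrow> real \<Rightarrow> real" where
  "trunc_sum f n x = (\<Sum>k=1..n. prime_trunc f (cf_digit k x))"

lemma lvl_at_top: "filterlim (\<lambda>j. real (lvl j)) at_top sequentially"
  unfolding lvl_def by real_asymp

lemma eventually_lvl_ge_2: "eventually (\<lambda>j. lvl j \<ge> 2) sequentially"
  using lvl_at_top[unfolded filterlim_at_top, rule_format, of 2] by eventually_elim simp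

lemma measurable_trunc_sum [measurable]: "trunc_sum f n \<in> borel_measurable borel"
  unfolding trunc_sum_def by measurable

lemma trunc_sum_bounds: "0 \<le> trunc_sum f n x" "trunc_sum f n x \<le> real n * prime_trunc.bound f"
proof -
  show "0 \<le> trunc_sum f n x"
    unfolding trunc_sum_def by (intro sum_nonneg prime_trunc.w_nonneg)
  have "trunc_sum f n x \<le> (\<Sum>k=1..n. prime_trunc.bound f)"
    unfolding trunc_sum_def by (intro sum_mono prime_trunc.w_le_bound)
  then show "trunc_sum f n x \<le> real n * prime_trunc.bound f" by simp
qed

text \<open>Chebyshev's inequality in mean-square form: the variances of the normalised sums are
  summable. The growth hypothesis ranges over all \<open>C\<close> because the constant of
  \<open>mertens_second\<close> is only known to exist. \<open>N\<close> is left open since both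
  ends of a block, \<open>blk j\<close> and \<open>blk (Suc j)\<close>, occur with the level of the
  same j.\<close>

lemma AE_trunc_sum_law:
  assumes "\<And>C. (\<lambda>j. (20 * real (lvl j) / ln (real (lvl j)) + 48 * (ln (ln (real (lvl j))) + C) ^ 2) / real (N j))
      \<in> O(\<lambda>j. real j powr (-6/5))"
    and N: "\<And>j. N j > 0"
  shows "AE x in gauss_measure. (\<lambda>j. trunc_sum (lvl j) (N j) x / real (N j) - prime_trunc.mean (lvl j)) \<longlonglongrightarrow> 0"
proof -
  define Z where "Z = (\<lambda>j x. (trunc_sum (lvl j) (N j) x / real (N j) - prime_trunc.mean (lvl j)) ^ 2)"
  obtain C where C: "\<And>n. n \<ge> 2 \<Longrightarrow> \<bar>(\<Sum>p\<in>{p\<in>{1..n}. prime p}. 1 / real p) - ln (ln (real n))\<bar> \<le> C"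
    using mertens_second by blast
  have Z: "(\<integral>x. Z j x \<partial>gauss_measure) \<le> (20 * real (lvl j) / ln (real (lvl j)) + 48 * (ln (ln (real (lvl j))) + C) ^ 2) / real (N j)"
    if f: "lvl j \<ge> 2" for j
  proof -
    let ?f = "lvl j"
    have "Z j x = (trunc_sum ?f (N j) x - real (N j) * prime_trunc.mean ?f) ^ 2 / real (N j) ^ 2" for x
      using N[of j] unfolding Z_def power_divide[symmetric] by (simp add: diff_divide_distrib)
    then have "(\<integral>x. Z j x \<partial>gauss_measure) =
        (\<integral>x. (trunc_sum ?f (N j) x - real (N j) * prime_trunc.mean ?f) ^ 2 \<partial>gauss_measure) / real (N j) ^ 2"
      by simp
    also have "\<dots> \<le> (real (N j) * (2 * (\<Sum>m=1..?f. prime_trunc ?f m ^ 2 / (real m * (real m + 1))) + 48 * prime_trunc.mass ?f ^ 2)) / real (N j) ^ 2"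
      unfolding trunc_sum_def by (intro divide_right_mono prime_trunc.variance_le) simp
    also have "\<dots> = (2 * (\<Sum>m=1..?f. prime_trunc ?f m ^ 2 / (real m * (real m + 1))) + 48 * prime_trunc.mass ?f ^ 2) / real (N j)"
      by (simp add: power2_eq_square)
    also have "\<dots> \<le> (2 * (10 * real ?f / ln (real ?f)) + 48 * (ln (ln (real ?f)) + C) ^ 2) / real (N j)"
    proof (intro divide_right_mono add_mono mult_left_mono power_mono prime_trunc_second_moment_le f)
      show "prime_trunc.mass ?f \<le> ln (ln (real ?f)) + C"
        using prime_trunc_mass_le[of ?f] C[OF f] by linarith
    qed (auto simp: prime_trunc.mass_nonneg)
    finally show ?thesis by simp
  qed
  have "AE x in gauss_measure. (\<lambda>j. Z j x) \<longlonglongrightarrow> 0"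
  proof (rule AE_tendsto_zero_of_summable_integral)
    fix j
    show "0 \<le> Z j x" for x by (simp add: Z_def)
    show "integrable gauss_measure (Z j)"
    proof (rule integrable_gauss_bounded[where B = "(prime_trunc.bound (lvl j) + \<bar>prime_trunc.mean (lvl j)\<bar>) ^ 2"])
      show "Z j \<in> borel_measurable borel" unfolding Z_def by measurable
      fix x :: real
      have "0 \<le> trunc_sum (lvl j) (N j) x / real (N j)" "trunc_sum (lvl j) (N j) x / real (N j) \<le> prime_trunc.bound (lvl j)"
        using trunc_sum_bounds[of "lvl j" "N j" x] N[of j] by (auto simp: field_simps)
      then have "\<bar>trunc_sum (lvl j) (N j) x / real (N j) - prime_trunc.mean (lvl j)\<bar> \<le> prime_trunc.bound (lvl j) + \<bar>prime_trunc.mean (lvl j)\<bar>"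
        by linarith
      then have "\<bar>trunc_sum (lvl j) (N j) x / real (N j) - prime_trunc.mean (lvl j)\<bar> ^ 2 \<le> (prime_trunc.bound (lvl j) + \<bar>prime_trunc.mean (lvl j)\<bar>) ^ 2"
        by (intro power_mono) auto
      then show "\<bar>Z j x\<bar> \<le> (prime_trunc.bound (lvl j) + \<bar>prime_trunc.mean (lvl j)\<bar>) ^ 2"
        by (simp add: Z_def)
    qed
  next
    have "summable (\<lambda>j. (20 * real (lvl j) / ln (real (lvl j)) + 48 * (ln (ln (real (lvl j))) + C) ^ 2) / real (N j))"
      by (rule summable_comparison_test_bigo[OF _ assms(1)]) (simp add: summable_real_powr_iff)
    moreover have "0 \<le> (\<integral>x. Z j x \<partial>gauss_measure)" for j
      by (intro integral_nonneg_AE) (auto simp: Z_def)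
    ultimately show "summable (\<lambda>j. \<integral>x. Z j x \<partial>gauss_measure)"
      using eventually_lvl_ge_2
      by (elim summable_comparison_test_ev[rotated]) (auto elim!: eventually_mono intro!: Z)
  qed
  then show ?thesis
  proof eventually_elim
    fix x assume "(\<lambda>j. Z j x) \<longlonglongrightarrow> 0"
    then have "(\<lambda>j. sqrt (Z j x)) \<longlonglongrightarrow> sqrt 0" by (rule tendsto_real_sqrt)
    then show "(\<lambda>j. trunc_sum (lvl j) (N j) x / real (N j) - prime_trunc.mean (lvl j)) \<longlonglongrightarrow> 0"
      unfolding Z_def by (simp add: tendsto_rabs_zero_iff)
  qed
qed

lemma exceeds_cf_digit:
  assumes "k \<ge> 1"
  shows "exceeds u ((gauss_map ^^ (k - 1)) x) = (if prime_digit k x > u then 1 else 0)"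
  using cf_digit_conv[OF assms, of x] by (auto simp: exceeds_def prime_digit_def)

text \<open>The integral of \<open>Z j\<close> is the expected number of ordered pairs of exceeding
  indices, at most the square of \<open>blk (Suc j)\<close> times the tail bound; this is
  summable.\<close>

lemma AE_no_double_exceedance:
  "AE x in gauss_measure. eventually (\<lambda>j. \<forall>k\<in>{1..blk (Suc j)}. \<forall>l\<in>{1..blk (Suc j)}.
     k \<noteq> l \<longrightarrow> \<not> (prime_digit k x > lvl j \<and> prime_digit l x > lvl j)) sequentially"
proof -
  define e where "e j k x = exceeds (lvl j) ((gauss_map ^^ k) x)" for j k x
  define Z where "Z j x = (\<Sum>k<blk (Suc j). \<Sum>l<blk (Suc j). if k = l then 0 else e j k x * e j l x)" for j x
  have [measurable]: "e j k \<in> borel_measurable borel" for j k unfolding e_def by measurable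
  have e: "0 \<le> e j k x" "e j k x \<le> 1" for j k x by (auto simp: e_def exceeds_bounds)
  have int_e: "integrable gauss_measure (\<lambda>x. if k = l then 0 else e j k x * e j l x)" for j k l
    using e by (intro integrable_gauss_bounded[where B = 1]) (auto simp: abs_mult intro!: mult_le_one)
  have Z: "(\<integral>x. Z j x \<partial>gauss_measure) \<le> (real (blk (Suc j)) * (24 / (real (lvl j) * ln (real (lvl j))))) ^ 2"
    if f: "lvl j \<ge> 2" for j
  proof -
    have "(\<integral>x. Z j x \<partial>gauss_measure) = (\<Sum>k<blk (Suc j). \<Sum>l<blk (Suc j). \<integral>x. (if k = l then 0 else e j k x * e j l x) \<partial>gauss_measure)"
      unfolding Z_def
      by (subst Bochner_Integration.integral_sum, intro Bochner_Integration.integrable_sum int_e)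
         (subst Bochner_Integration.integral_sum, rule int_e, rule refl)
    also have "\<dots> \<le> (\<Sum>k<blk (Suc j). \<Sum>l<blk (Suc j). (24 / (real (lvl j) * ln (real (lvl j)))) ^ 2)"
    proof (intro sum_mono)
      fix k l
      show "(\<integral>x. (if k = l then 0 else e j k x * e j l x) \<partial>gauss_measure) \<le> (24 / (real (lvl j) * ln (real (lvl j)))) ^ 2"
        using integral_exceeds_pair_le[OF f, of k l] by (cases "k = l") (simp_all add: e_def)
    qed
    also have "\<dots> = (real (blk (Suc j)) * (24 / (real (lvl j) * ln (real (lvl j))))) ^ 2"
      by (simp only: sum_constant card_lessThan power_mult_distrib) (simp add: power2_eq_square)
    finally show ?thesis .
  qed
  have "AE x in gauss_measure. (\<lambda>j. Z j x) \<longlonglongrightarrow> 0"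
  proof (rule AE_tendsto_zero_of_summable_integral)
    fix j
    show nonneg: "0 \<le> Z j x" for j x unfolding Z_def using e by (intro sum_nonneg) auto
    show "integrable gauss_measure (Z j)"
      unfolding Z_def by (intro Bochner_Integration.integrable_sum int_e)
  next
    have "summable (\<lambda>j. (real (blk (Suc j)) * (24 / (real (lvl j) * ln (real (lvl j))))) ^ 2)"
    proof (rule summable_comparison_test_bigo)
      show "(\<lambda>j. (real (blk (Suc j)) * (24 / (real (lvl j) * ln (real (lvl j))))) ^ 2) \<in> O(\<lambda>j. real j powr (-6/5))"
        unfolding blk_def lvl_def by real_asymp
    qed (simp add: summable_real_powr_iff)
    moreover have "0 \<le> (\<integral>x. Z j x \<partial>gauss_measure)" for j
      unfolding Z_def using e by (intro integral_nonneg_AE AE_I2 sum_nonneg) auto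
    then have "norm (\<integral>x. Z j x \<partial>gauss_measure) \<le> (real (blk (Suc j)) * (24 / (real (lvl j) * ln (real (lvl j))))) ^ 2"
      if "lvl j \<ge> 2" for j
      using Z[OF that] by (simp only: real_norm_def abs_of_nonneg)
    then have "eventually (\<lambda>j. norm (\<integral>x. Z j x \<partial>gauss_measure) \<le> (real (blk (Suc j)) * (24 / (real (lvl j) * ln (real (lvl j))))) ^ 2) sequentially"
      using eventually_lvl_ge_2 by (rule eventually_mono[rotated])
    ultimately show "summable (\<lambda>j. \<integral>x. Z j x \<partial>gauss_measure)"
      by (rule summable_comparison_test_ev[rotated])
  qed
  then show ?thesis
  proof eventually_elim
    fix x assume "(\<lambda>j. Z j x) \<longlonglongrightarrow> 0"
    \<comment> \<open>\<open>Z j x\<close> counts ordered pairs, so a value below 1 means that there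
      are none.\<close>
    then have "eventually (\<lambda>j. Z j x < 1) sequentially" by (rule order_tendstoD) simp
    then show "eventually (\<lambda>j. \<forall>k\<in>{1..blk (Suc j)}. \<forall>l\<in>{1..blk (Suc j)}.
     k \<noteq> l \<longrightarrow> \<not> (prime_digit k x > lvl j \<and> prime_digit l x > lvl j)) sequentially"
    proof eventually_elim
      fix j assume less: "Z j x < 1"
      show "\<forall>k\<in>{1..blk (Suc j)}. \<forall>l\<in>{1..blk (Suc j)}.
         k \<noteq> l \<longrightarrow> \<not> (prime_digit k x > lvl j \<and> prime_digit l x > lvl j)"
      proof (intro ballI impI notI)
        fix k l assume kl: "k \<in> {1..blk (Suc j)}" "l \<in> {1..blk (Suc j)}" "k \<noteq> l"
          and exc: "lvl j < prime_digit k x \<and> lvl j < prime_digit l x"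
        let ?t = "\<lambda>k l. if k = l then 0 else e j k x * e j l x"
        have "1 = ?t (k - 1) (l - 1)"
          using exceeds_cf_digit[of k "lvl j" x] exceeds_cf_digit[of l "lvl j" x] kl exc by (auto simp: e_def)
        also have "\<dots> \<le> (\<Sum>l<blk (Suc j). ?t (k - 1) l)"
          using kl e by (intro member_le_sum) auto
        also have "\<dots> \<le> Z j x"
          unfolding Z_def using kl e by (intro member_le_sum[of "k - 1" _ "\<lambda>k. \<Sum>l<blk (Suc j). ?t k l"]) (auto intro!: sum_nonneg)
        finally show False using less by simp
      qed
    qed
  qed
qed

lemma mean_over_loglog:
  "(\<lambda>j. prime_trunc.mean (lvl j) / ln (ln (real (lvl j)))) \<longlonglongrightarrow> 1 / ln 2"
proof -
  obtain C where C: "\<And>f. f \<ge> 2 \<Longrightarrow> \<bar>prime_trunc.mean f - ln (ln (real f)) / ln 2\<bar> \<le> C"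
    using prime_trunc_mean_bounds by blast
  have inf: "filterlim (\<lambda>j. ln (ln (real (lvl j)))) at_top sequentially"
    unfolding lvl_def by real_asymp
  have "(\<lambda>j. prime_trunc.mean (lvl j) / ln (ln (real (lvl j))) - 1 / ln 2) \<longlonglongrightarrow> 0"
  proof (rule Lim_null_comparison)
    show "(\<lambda>j. C / ln (ln (real (lvl j)))) \<longlonglongrightarrow> 0"
      by (rule tendsto_divide_0[OF tendsto_const filterlim_at_top_imp_at_infinity[OF inf]])
    have "eventually (\<lambda>j. ln (ln (real (lvl j))) > 0) sequentially"
      using inf by (simp add: filterlim_at_top_dense)
    then show "eventually (\<lambda>j. norm (prime_trunc.mean (lvl j) / ln (ln (real (lvl j))) - 1 / ln 2) \<le> C / ln (ln (real (lvl j)))) sequentially"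
      using eventually_lvl_ge_2
    proof eventually_elim
      fix j assume pos: "ln (ln (real (lvl j))) > 0" and f: "lvl j \<ge> 2"
      have "prime_trunc.mean (lvl j) / ln (ln (real (lvl j))) - 1 / ln 2 = (prime_trunc.mean (lvl j) - ln (ln (real (lvl j))) / ln 2) / ln (ln (real (lvl j)))"
        using pos by (simp add: diff_divide_distrib)
      then show "norm (prime_trunc.mean (lvl j) / ln (ln (real (lvl j))) - 1 / ln 2) \<le> C / ln (ln (real (lvl j)))"
        using C[OF f] pos by (simp add: divide_right_mono)
    qed
  qed
  then show ?thesis by (rule LIM_zero_cancel)
qed

text \<open>Turns additive closeness to the truncated mean into a ratio. The normaliser
  \<open>c\<close> is any sequence asymptotic to ln (ln (lvl j)), so the iterated logarithm of
  either block end will do.\<close>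

lemma loglog_lvl_ratio_tendsto:
  assumes a: "(\<lambda>j. a j - prime_trunc.mean (lvl j)) \<longlonglongrightarrow> 0"
    and r: "(\<lambda>j. ln (ln (real (lvl j))) / c j) \<longlonglongrightarrow> 1" and c: "filterlim c at_top sequentially"
  shows "(\<lambda>j. ln 2 * (a j / c j)) \<longlonglongrightarrow> 1"
proof -
  have c0: "(\<lambda>j. inverse (c j)) \<longlonglongrightarrow> 0"
    by (rule tendsto_inverse_0_at_top[OF c])
  have "(\<lambda>j. ln 2 * ((a j - prime_trunc.mean (lvl j)) * inverse (c j) + prime_trunc.mean (lvl j) / ln (ln (real (lvl j))) * (ln (ln (real (lvl j))) / c j)))
     \<longlonglongrightarrow> ln 2 * (0 * 0 + 1 / ln 2 * 1)"
    by (intro tendsto_intros a c0 r mean_over_loglog)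
  moreover have "eventually (\<lambda>j. ln (ln (real (lvl j))) > 0) sequentially"
    unfolding lvl_def by real_asymp
  then have "eventually (\<lambda>j. ln 2 * ((a j - prime_trunc.mean (lvl j)) * inverse (c j) + prime_trunc.mean (lvl j) / ln (ln (real (lvl j))) * (ln (ln (real (lvl j))) / c j))
     = ln 2 * (a j / c j)) sequentially"
    by eventually_elim (simp add: divide_inverse left_diff_distrib)
  ultimately show ?thesis
    by (simp add: tendsto_cong)
qed

lemma blk_pos: "blk j > 0"
proof -
  have "\<lceil>exp (real j powr (9/10))\<rceil> > 0" by simp
  then show ?thesis unfolding blk_def by simp
qed

lemma AE_trimmed_law:
  "AE x in gauss_measure. (\<lambda>n. ln 2 / (real n * ln (ln (real n)))
       * ((\<Sum>k=1..n. real (prime_digit k x)) - real (max_prime_digit n x))) \<longlonglongrightarrow> 1"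
proof -
  have "AE x in gauss_measure. (\<lambda>j. trunc_sum (lvl j) (blk j) x / real (blk j) - prime_trunc.mean (lvl j)) \<longlonglongrightarrow> 0"
    by (rule AE_trunc_sum_law[OF _ blk_pos]) (unfold blk_def lvl_def, real_asymp)
  moreover have "AE x in gauss_measure. (\<lambda>j. trunc_sum (lvl j) (blk (Suc j)) x / real (blk (Suc j)) - prime_trunc.mean (lvl j)) \<longlonglongrightarrow> 0"
    by (rule AE_trunc_sum_law[OF _ blk_pos]) (unfold blk_def lvl_def, real_asymp)
  ultimately show ?thesis
    using AE_no_double_exceedance
  proof eventually_elim
    fix x
    assume A: "(\<lambda>j. trunc_sum (lvl j) (blk j) x / real (blk j) - prime_trunc.mean (lvl j)) \<longlonglongrightarrow> 0"
      and B: "(\<lambda>j. trunc_sum (lvl j) (blk (Suc j)) x / real (blk (Suc j)) - prime_trunc.mean (lvl j)) \<longlonglongrightarrow> 0"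
      and E: "eventually (\<lambda>j. \<forall>k\<in>{1..blk (Suc j)}. \<forall>l\<in>{1..blk (Suc j)}.
         k \<noteq> l \<longrightarrow> \<not> (prime_digit k x > lvl j \<and> prime_digit l x > lvl j)) sequentially"
    define LL where "LL n = ln (ln (real n))" for n :: nat
    \<comment> \<open>\<open>lo\<close> pairs the sum at the start of the block with the normaliser
      at its end, \<open>hi\<close> the other way round; both use the level of the same block. They
      bracket the trimmed average on the block and differ from its natural normalisation by
      \<open>ratio\<close>.\<close>
    define lo where "lo j = ln 2 / (real (blk (Suc j)) * LL (blk (Suc j))) * (trunc_sum (lvl j) (blk j) x - real (lvl j))" for j
    define hi where "hi j = ln 2 / (real (blk j) * LL (blk j)) * trunc_sum (lvl j) (blk (Suc j)) x" for j
    define T where "T n = (\<Sum>k=1..n. real (prime_digit k x)) - real (max_prime_digit n x)" for n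
    have ratio: "(\<lambda>j. real (blk (Suc j)) / real (blk j)) \<longlonglongrightarrow> 1"
      unfolding blk_def by real_asymp
    have "(\<lambda>j. (trunc_sum (lvl j) (blk j) x / real (blk j) - prime_trunc.mean (lvl j)) - real (lvl j) / real (blk j)) \<longlonglongrightarrow> 0 - 0"
    proof (intro tendsto_diff A)
      show "(\<lambda>j. real (lvl j) / real (blk j)) \<longlonglongrightarrow> 0" unfolding lvl_def blk_def by real_asymp
    qed
    then have A': "(\<lambda>j. (trunc_sum (lvl j) (blk j) x - real (lvl j)) / real (blk j) - prime_trunc.mean (lvl j)) \<longlonglongrightarrow> 0"
      by (simp add: diff_divide_distrib algebra_simps)
    have "(\<lambda>j. ln 2 * ((trunc_sum (lvl j) (blk j) x - real (lvl j)) / real (blk j) / LL (blk (Suc j)))) \<longlonglongrightarrow> 1"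
    proof (rule loglog_lvl_ratio_tendsto[OF A'])
      show "(\<lambda>j. ln (ln (real (lvl j))) / LL (blk (Suc j))) \<longlonglongrightarrow> 1" unfolding LL_def lvl_def blk_def by real_asymp
      show "filterlim (\<lambda>j. LL (blk (Suc j))) at_top sequentially" unfolding LL_def blk_def by real_asymp
    qed
    from tendsto_divide[OF this ratio]
    have "(\<lambda>j. ln 2 * ((trunc_sum (lvl j) (blk j) x - real (lvl j)) / real (blk j) / LL (blk (Suc j))) / (real (blk (Suc j)) / real (blk j))) \<longlonglongrightarrow> 1"
      by simp
    also have "(\<lambda>j. ln 2 * ((trunc_sum (lvl j) (blk j) x - real (lvl j)) / real (blk j) / LL (blk (Suc j))) / (real (blk (Suc j)) / real (blk j))) = lo"
      using blk_pos by (intro ext) (simp add: lo_def less_imp_neq[symmetric] mult_ac)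
    finally have lo: "lo \<longlonglongrightarrow> 1" .
    have "(\<lambda>j. ln 2 * (trunc_sum (lvl j) (blk (Suc j)) x / real (blk (Suc j)) / LL (blk j))) \<longlonglongrightarrow> 1"
    proof (rule loglog_lvl_ratio_tendsto[OF B])
      show "(\<lambda>j. ln (ln (real (lvl j))) / LL (blk j)) \<longlonglongrightarrow> 1" unfolding LL_def lvl_def blk_def by real_asymp
      show "filterlim (\<lambda>j. LL (blk j)) at_top sequentially" unfolding LL_def blk_def by real_asymp
    qed
    from tendsto_mult[OF this ratio]
    have "(\<lambda>j. ln 2 * (trunc_sum (lvl j) (blk (Suc j)) x / real (blk (Suc j)) / LL (blk j)) * (real (blk (Suc j)) / real (blk j))) \<longlonglongrightarrow> 1"
      by simp
    also have "(\<lambda>j. ln 2 * (trunc_sum (lvl j) (blk (Suc j)) x / real (blk (Suc j)) / LL (blk j)) * (real (blk (Suc j)) / real (blk j))) = hi"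
      using blk_pos by (intro ext) (simp add: hi_def less_imp_neq[symmetric] mult_ac)
    finally have hi: "hi \<longlonglongrightarrow> 1" .
    have "(\<lambda>n. ln 2 / (real n * LL n) * T n) \<longlonglongrightarrow> 1"
    proof (rule tendsto_of_blocks[OF _ lo hi])
      show "filterlim blk at_top sequentially"
        unfolding blk_def by real_asymp
      \<comment> \<open>Enlarging a denominator lowers a quotient only if the numerator is
        nonnegative. Positivity of \<open>lo j\<close> yields this for the truncated sum minus the
        level, and then for \<open>T n\<close>.\<close>
      have "eventually (\<lambda>j. 0 < lo j) sequentially" using lo by (rule order_tendstoD) simp
      \<comment> \<open>Beyond exp 1 the iterated logarithm is positive as well as
        increasing.\<close>
      moreover have "eventually (\<lambda>j. real (blk j) > exp 1) sequentially" unfolding blk_def by real_asymp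
      ultimately show "eventually (\<lambda>j. \<forall>n. blk j \<le> n \<and> n < blk (Suc j) \<longrightarrow>
          lo j \<le> ln 2 / (real n * LL n) * T n \<and> ln 2 / (real n * LL n) * T n \<le> hi j) sequentially"
        using E
      proof eventually_elim
        fix j assume lo_pos: "0 < lo j" and big: "exp 1 < real (blk j)"
          and excl: "\<forall>k\<in>{1..blk (Suc j)}. \<forall>l\<in>{1..blk (Suc j)}.
            k \<noteq> l \<longrightarrow> \<not> (lvl j < prime_digit k x \<and> lvl j < prime_digit l x)"
        show "\<forall>n. blk j \<le> n \<and> n < blk (Suc j) \<longrightarrow>
          lo j \<le> ln 2 / (real n * LL n) * T n \<and> ln 2 / (real n * LL n) * T n \<le> hi j"
        proof (intro allI impI)
          fix n assume n: "blk j \<le> n \<and> n < blk (Suc j)"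
          have trunc: "real (if prime_digit k x \<le> lvl j then prime_digit k x else 0) = prime_trunc (lvl j) (cf_digit k x)" for k
            by (auto simp: prime_digit_def prime_trunc_def)
          have "1 \<le> n" using n blk_pos[of j] by linarith
          then have T: "trunc_sum (lvl j) (blk j) x - real (lvl j) \<le> T n" "T n \<le> trunc_sum (lvl j) (blk (Suc j)) x"
            using trimmed_sum_bounds[where n' = "blk (Suc j)" and X = "\<lambda>k. prime_digit k x" and f = "lvl j" and n = n and N = "blk j"] excl n
            unfolding trunc T_def max_prime_digit_def trunc_sum_def by auto
          have LL_mono: "0 < LL m \<and> LL m \<le> LL m'" if "exp 1 < real m" "m \<le> m'" for m m'
          proof -
            have m: "0 < real m" using that(1) by (rule less_trans[rotated]) simp
            have "ln (exp 1) < ln (real m)" using m that(1) by (subst ln_less_cancel_iff) auto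
            then have "1 < ln (real m)" by simp
            moreover have "ln (real m) \<le> ln (real m')" using m that(2) by (subst ln_le_cancel_iff) auto
            ultimately show ?thesis unfolding LL_def by simp
          qed
          have big': "exp 1 < real n" using big n by linarith
          have pos: "0 < LL (blk j)" "LL (blk j) \<le> LL n" "LL n \<le> LL (blk (Suc j))"
            using LL_mono[OF big, of n] LL_mono[OF big', of "blk (Suc j)"] n by auto
          have d: "0 < real (blk j) * LL (blk j)" "real (blk j) * LL (blk j) \<le> real n * LL n"
            "real n * LL n \<le> real (blk (Suc j)) * LL (blk (Suc j))"
            using pos n blk_pos[of j] by (auto intro!: mult_mono)
          have "0 < trunc_sum (lvl j) (blk j) x - real (lvl j)"
          proof (rule ccontr)
            assume "\<not> ?thesis"
            then have "lo j \<le> 0" unfolding lo_def using d by (intro mult_nonneg_nonpos) auto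
            with lo_pos show False by simp
          qed
          with T(1) have "0 \<le> T n" by linarith
          have "lo j \<le> ln 2 / (real n * LL n) * (trunc_sum (lvl j) (blk j) x - real (lvl j))"
            unfolding lo_def using \<open>0 < trunc_sum (lvl j) (blk j) x - real (lvl j)\<close>
            by (intro mult_right_mono frac_le[OF _ order_refl less_le_trans[OF d(1,2)] d(3)]) auto
          also have "\<dots> \<le> ln 2 / (real n * LL n) * T n"
            using d T by (intro mult_left_mono) auto
          finally have 1: "lo j \<le> ln 2 / (real n * LL n) * T n" .
          have "ln 2 / (real n * LL n) * T n \<le> ln 2 / (real (blk j) * LL (blk j)) * T n"
            using \<open>0 \<le> T n\<close> by (intro mult_right_mono frac_le[OF _ order_refl d(1,2)]) auto
          also have "\<dots> \<le> hi j"
            unfolding hi_def using d T by (intro mult_left_mono) auto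
          finally show "lo j \<le> ln 2 / (real n * LL n) * T n \<and> ln 2 / (real n * LL n) * T n \<le> hi j"
            using 1 by blast
        qed
      qed
    qed
    then show "(\<lambda>n. ln 2 / (real n * ln (ln (real n)))
       * ((\<Sum>k=1..n. real (prime_digit k x)) - real (max_prime_digit n x))) \<longlonglongrightarrow> 1"
      unfolding LL_def T_def .
  qed
qed

text \<open>The Gauss density is positive on all of \<open>{0<..1}\<close>, so a Gauss null set
  meets this interval in a Lebesgue null set.\<close>

lemma AE_lebesgue_on_of_gauss_measure:
  assumes "AE x in gauss_measure. P x"
  shows "AE x in lebesgue_on {0<..1}. P x"
proof -
  have "AE x in lebesgue. x \<in> {0<..1} \<longrightarrow> P x"
    using assms unfolding AE_gauss_measure_iff by (rule AE_completion)
  then show ?thesis by (subst AE_restrict_space_iff) auto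
qed

theorem theorem2p6:
  shows "(AE x in lebesgue_on {0<..1::real}.
            filterlim (\<lambda>n. (\<Sum>k=1..n. real (prime_digit k x)) / real n) at_top sequentially)
       \<and> (AE x in lebesgue_on {0<..1::real}.
            (\<lambda>n. ln 2 / (real n * ln (ln (real n)))
                  * ((\<Sum>k=1..n. real (prime_digit k x)) - real (max_prime_digit n x)))
            \<longlonglongrightarrow> 1)"
proof
  show b: "AE x in lebesgue_on {0<..1::real}.
            (\<lambda>n. ln 2 / (real n * ln (ln (real n)))
                  * ((\<Sum>k=1..n. real (prime_digit k x)) - real (max_prime_digit n x)))
            \<longlonglongrightarrow> 1"
    by (rule AE_lebesgue_on_of_gauss_measure[OF AE_trimmed_law])
  show "AE x in lebesgue_on {0<..1::real}.
            filterlim (\<lambda>n. (\<Sum>k=1..n. real (prime_digit k x)) / real n) at_top sequentially"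
    using b
  proof eventually_elim
    fix x :: real
    define T where "T n = (\<Sum>k=1..n. real (prime_digit k x)) - real (max_prime_digit n x)" for n
    assume "(\<lambda>n. ln 2 / (real n * ln (ln (real n)))
                  * ((\<Sum>k=1..n. real (prime_digit k x)) - real (max_prime_digit n x)))
            \<longlonglongrightarrow> 1"
    then have *: "(\<lambda>n. ln 2 / (real n * ln (ln (real n))) * T n) \<longlonglongrightarrow> 1"
      unfolding T_def .
    \<comment> \<open>Multiplying the limit of part (b) by this factor cancels the normalisation and
      leaves \<open>T n / real n\<close>, a lower bound for the average.\<close>
    have "filterlim (\<lambda>n. ln (ln (real n)) / ln 2) at_top sequentially" by real_asymp
    from filterlim_tendsto_pos_mult_at_top[OF * _ this]
    have "filterlim (\<lambda>n. ln 2 / (real n * ln (ln (real n))) * T n * (ln (ln (real n)) / ln 2)) at_top sequentially"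
      by simp
    moreover have "eventually (\<lambda>n. ln (ln (real n)) > 0) sequentially" by real_asymp
    then have "eventually (\<lambda>n. ln 2 / (real n * ln (ln (real n))) * T n * (ln (ln (real n)) / ln 2) \<le>
        (\<Sum>k=1..n. real (prime_digit k x)) / real n) sequentially"
    proof eventually_elim
      fix n assume "ln (ln (real n)) > 0"
      then have "ln 2 / (real n * ln (ln (real n))) * T n * (ln (ln (real n)) / ln 2) = T n / real n"
        by simp
      also have "\<dots> \<le> (\<Sum>k=1..n. real (prime_digit k x)) / real n"
        by (intro divide_right_mono) (auto simp: T_def)
      finally show "ln 2 / (real n * ln (ln (real n))) * T n * (ln (ln (real n)) / ln 2) \<le>
        (\<Sum>k=1..n. real (prime_digit k x)) / real n" .
    qed
    ultimately show "filterlim (\<lambda>n. (\<Sum>k=1..n. real (prime_digit k x)) / real n) at_top sequentially"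
      by (rule filterlim_at_top_mono)
  qed
qed

end
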